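(* Let $Z$ be an ACM fat point scheme in $\mathbb{P}^1\times\mathbb{P}^1$ with $\alpha_Z=(\alpha_1,\dots,\alpha_m)$ (non-increasing). Define $C_Z=\{(m,0),(0,\alpha_1)\}\cup\{(i-1,\alpha_i) : 2\le i\le m,\ \alpha_i<\alpha_{i-1}\}$ and $V_Z=\{(m,\alpha_m)\}\cup\{(i-1,\alpha_{i-1}) : 2\le i\le m,\ \alpha_i<\alpha_{i-1}\}$. Then the bigraded minimal free resolution of $I_Z$ is $$0\to\bigoplus_{(v_1,v_2)\in V_Z}R(-v_1,-v_2)\to\bigoplus_{(c_1,c_2)\in C_Z}R(-c_1,-c_2)\to I_Z\to 0.$$
   Context: $\mathbf{k}$ algebraically closed, $R=\mathbf{k}[x_0,x_1,y_0,y_1]$ bigraded with $\deg x_i=(1,0)$, $\deg y_i=(0,1)$; a fat point scheme $Z$ has ideal $I_Z=\bigcap\wp_{P_k}^{m_k}$ (where $[a_0:a_1]\times[b_0:b_1]$ has ideal $(a_1x_0-a_0x_1,b_1y_0-b_0y_1)$) and is ACM if $R/I_Z$ is Cohen–Macaulay. With $\pi_1(\mathrm{Supp}\,Z)=\{R_1,\dots,R_r\}$, $\pi_2(\mathrm{Supp}\,Z)=\{Q_1,\dots,Q_t\}$ and $m_{ij}$ the multiplicity of $R_i\times Q_j$ ($0$ if absent): $l_i=\max_j m_{ij}$, $a_{i,k}=\sum_j(m_{ij}-k)_+$ ($0\le k\le l_i-1$, $(n)_+=\max\{0,n\}$), and $\alpha_Z$ is the tuple of all $a_{i,k}$ in non-increasing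 order. $R(-a,-b)$ denotes $R$ with bigrading shifted by $(a,b)$. *)

theory Defs
  imports "HOL-Library.Poly_Mapping" "HOL-Library.Extended_Nat"
    "HOL-Computational_Algebra.Polynomial"
begin

datatype var = X0 | X1 | Y0 | Y1

type_synonym 'k bpoly = "(var \<Rightarrow>\<^sub>0 nat) \<Rightarrow>\<^sub>0 'k"

definition Var :: "var \<Rightarrow> 'k::comm_ring_1 bpoly" where
  "Var v = Poly_Mapping.single (Poly_Mapping.single v 1) 1"

definition Const :: "'k::comm_ring_1 \<Rightarrow> 'k bpoly" where
  "Const c = Poly_Mapping.single 0 c"

definition bideg :: "(var \<Rightarrow>\<^sub>0 nat) \<Rightarrow> int \<times> int" where
  "bideg e = (int (Poly_Mapping.lookup e X0 + Poly_Mapping.lookup e X1), int (Poly_Mapping.lookup e Y0 + Poly_Mapping.lookup e Y1))"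

text \<open>bihomogeneous of bidegree d (the zero polynomial is bihomogeneous of every
  bidegree; a negative bidegree forces the polynomial to be zero)\<close>
definition bihomog :: "'k::zero bpoly \<Rightarrow> int \<times> int \<Rightarrow> bool" where
  "bihomog p d \<longleftrightarrow> (\<forall>e\<in>Poly_Mapping.keys p. bideg e = d)"

definition ideal_gen :: "'a::comm_ring_1 set \<Rightarrow> 'a set" where
  "ideal_gen G = {x. \<exists>S c. finite S \<and> S \<subseteq> G \<and> x = (\<Sum>g\<in>S. c g * g)}"

definition is_ideal :: "'a::comm_ring_1 set \<Rightarrow> bool" where
  "is_ideal I \<longleftrightarrow> 0 \<in> I \<and> (\<forall>a\<in>I. \<forall>b\<in>I. a + b \<in> I) \<and> (\<forall>r. \<forall>a\<in>I. r * a \<in> I)"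

definition prime_ideal :: "'a::comm_ring_1 set \<Rightarrow> bool" where
  "prime_ideal P \<longleftrightarrow> is_ideal P \<and> P \<noteq> UNIV \<and> (\<forall>a b. a * b \<in> P \<longrightarrow> a \<in> P \<or> b \<in> P)"

definition ideal_mult :: "'a::comm_ring_1 set \<Rightarrow> 'a set \<Rightarrow> 'a set" where
  "ideal_mult I J = ideal_gen {a * b | a b. a \<in> I \<and> b \<in> J}"

primrec ideal_pow :: "'a::comm_ring_1 set \<Rightarrow> nat \<Rightarrow> 'a set" where
  "ideal_pow I 0 = UNIV"
| "ideal_pow I (Suc n) = ideal_mult I (ideal_pow I n)"

definition max_ideal :: "'k::comm_ring_1 bpoly set" where
  "max_ideal = ideal_gen (range Var)"

definition pt_ideal :: "'k::comm_ring_1 \<times> 'k \<Rightarrow> 'k \<times> 'k \<Rightarrow> 'k bpoly set" where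
  "pt_ideal a b = ideal_gen
     {Const (snd a) * Var X0 - Const (fst a) * Var X1,
      Const (snd b) * Var Y0 - Const (fst b) * Var Y1}"

text \<open>A fat point scheme Z is described as in the paper by the distinct points
  R_0..R_(r-1) of pi_1(Supp Z), Q_0..Q_(t-1) of pi_2(Supp Z) (given by homogeneous
  coordinates) and the multiplicities m i j of R_i x Q_j (0 if absent).\<close>
definition valid_fat_data ::
  "nat \<Rightarrow> nat \<Rightarrow> (nat \<Rightarrow> 'k::field \<times> 'k) \<Rightarrow> (nat \<Rightarrow> 'k \<times> 'k) \<Rightarrow> (nat \<Rightarrow> nat \<Rightarrow> nat) \<Rightarrow> bool" where
  "valid_fat_data r t R Q m \<longleftrightarrow>
     0 < r \<and> 0 < t \<and>
     (\<forall>i<r. R i \<noteq> (0, 0)) \<and> (\<forall>j<t. Q j \<noteq> (0, 0)) \<and>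
     (\<forall>i<r. \<forall>i'<r. i \<noteq> i' \<longrightarrow> fst (R i) * snd (R i') \<noteq> snd (R i) * fst (R i')) \<and>
     (\<forall>j<t. \<forall>j'<t. j \<noteq> j' \<longrightarrow> fst (Q j) * snd (Q j') \<noteq> snd (Q j) * fst (Q j')) \<and>
     (\<forall>i<r. \<exists>j<t. 0 < m i j) \<and> (\<forall>j<t. \<exists>i<r. 0 < m i j)"

definition fat_ideal ::
  "nat \<Rightarrow> nat \<Rightarrow> (nat \<Rightarrow> 'k::field \<times> 'k) \<Rightarrow> (nat \<Rightarrow> 'k \<times> 'k) \<Rightarrow> (nat \<Rightarrow> nat \<Rightarrow> nat) \<Rightarrow> 'k bpoly set" where
  "fat_ideal r t R Q m =
     \<Inter> {ideal_pow (pt_ideal (R i) (Q j)) (m i j) | i j. i < r \<and> j < t \<and> 0 < m i j}"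

definition regular_seq :: "'a::comm_ring_1 set \<Rightarrow> 'a list \<Rightarrow> bool" where
  "regular_seq J fs \<longleftrightarrow>
     (\<forall>i<length fs. \<forall>g. fs ! i * g \<in> ideal_gen (J \<union> set (take i fs))
                       \<longrightarrow> g \<in> ideal_gen (J \<union> set (take i fs))) \<and>
     ideal_gen (J \<union> set fs) \<noteq> UNIV"

definition depth_quot :: "'k::comm_ring_1 bpoly set \<Rightarrow> enat" where
  "depth_quot J = Sup {enat (length fs) | fs. set fs \<subseteq> max_ideal \<and> regular_seq J fs}"

definition krull_dim_quot :: "'a::comm_ring_1 set \<Rightarrow> enat" where
  "krull_dim_quot J = Sup {enat n | n. \<exists>P. (\<forall>i\<le>n. prime_ideal (P i)) \<and> J \<subseteq> P 0 \<and>
                                             (\<forall>i<n. P i \<subset> P (Suc i))}"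

text \<open>R/J is Cohen-Macaulay (J homogeneous): depth = dimension\<close>
definition cohen_macaulay_quot :: "'k::comm_ring_1 bpoly set \<Rightarrow> bool" where
  "cohen_macaulay_quot J \<longleftrightarrow> depth_quot J = krull_dim_quot J"

definition l_Z :: "nat \<Rightarrow> (nat \<Rightarrow> nat \<Rightarrow> nat) \<Rightarrow> nat \<Rightarrow> nat" where
  "l_Z t m i = Max (m i ` {..<t})"

text \<open>a_{i,k} = sum_j (m_ij - k)_+ ; nat subtraction is truncated\<close>
definition a_Z :: "nat \<Rightarrow> (nat \<Rightarrow> nat \<Rightarrow> nat) \<Rightarrow> nat \<Rightarrow> nat \<Rightarrow> nat" where
  "a_Z t m i k = (\<Sum>j<t. m i j - k)"

text \<open>alpha_Z as a non-increasing list; alpha_i of the paper is (alpha_Z ! (i-1))\<close>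
definition alpha_Z :: "nat \<Rightarrow> nat \<Rightarrow> (nat \<Rightarrow> nat \<Rightarrow> nat) \<Rightarrow> nat list" where
  "alpha_Z r t m = rev (sort (concat (map (\<lambda>i. map (a_Z t m i) [0..<l_Z t m i]) [0..<r])))"

definition C_Z :: "nat list \<Rightarrow> (nat \<times> nat) set" where
  "C_Z al = {(length al, 0), (0, al ! 0)} \<union>
     {(i - 1, al ! (i - 1)) | i. 2 \<le> i \<and> i \<le> length al \<and> al ! (i - 1) < al ! (i - 2)}"

definition V_Z :: "nat list \<Rightarrow> (nat \<times> nat) set" where
  "V_Z al = {(length al, al ! (length al - 1))} \<union>
     {(i - 1, al ! (i - 2)) | i. 2 \<le> i \<and> i \<le> length al \<and> al ! (i - 1) < al ! (i - 2)}"

text \<open>0 -> (+)_{v in V} R(-v) --N--> (+)_{c in C} R(-c) --g--> I -> 0 is a bigraded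
  (degree-preserving) minimal free resolution of I: g c is bihomogeneous of degree c,
  the matrix entry N v c bihomogeneous of degree v - c, exactness at each spot, and
  minimality (all entries of N lie in the homogeneous maximal ideal).\<close>
definition has_min_resolution ::
  "'k::comm_ring_1 bpoly set \<Rightarrow> (nat \<times> nat) set \<Rightarrow> (nat \<times> nat) set \<Rightarrow> bool" where
  "has_min_resolution I C V \<longleftrightarrow>
    (\<exists>(g :: nat \<times> nat \<Rightarrow> 'k bpoly) (N :: nat \<times> nat \<Rightarrow> nat \<times> nat \<Rightarrow> 'k bpoly).
       (\<forall>c\<in>C. bihomog (g c) (int (fst c), int (snd c)) \<and> g c \<in> I) \<and>
       ideal_gen (g ` C) = I \<and>
       (\<forall>v\<in>V. \<forall>c\<in>C. bihomog (N v c) (int (fst v) - int (fst c), int (snd v) - int (snd c))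
                     \<and> N v c \<in> max_ideal) \<and>
       (\<forall>h. (\<Sum>c\<in>C. h c * g c) = 0 \<longleftrightarrow>
            (\<exists>s. \<forall>c\<in>C. h c = (\<Sum>v\<in>V. s v * N v c))) \<and>
       (\<forall>s. (\<forall>c\<in>C. (\<Sum>v\<in>V. s v * N v c) = 0) \<longrightarrow> (\<forall>v\<in>V. s v = 0)))"

end

theory Submission
  imports Defs
begin

text \<open>
  Let \<open>L\<^sub>i\<close> and \<open>M\<^sub>j\<close> be the linear forms of \<open>R\<^sub>i\<close> and \<open>Q\<^sub>j\<close>, and call the vectors
  \<open>w\<^sub>i\<^sub>,\<^sub>k = ((m\<^sub>i\<^sub>j - k)\<^sub>+)\<^sub>j\<close> the rows of \<open>Z\<close>.

  If any two rows are comparable, then a largest row \<open>w\<^sub>i\<^sub>,\<^sub>0\<close> exists, and an element of \<open>I\<^sub>Z\<close> is a multiple of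
  \<open>\<Prod>\<^sub>j M\<^sub>j\<close> to the exponents \<open>w\<^sub>i\<^sub>,\<^sub>0\<close> plus \<open>L\<^sub>i\<close> times an element of the ideal of the scheme without that
  row. Iterating, \<open>I\<^sub>Z\<close> is generated by products \<open>A\<^sub>s B\<^sub>s\<close>, where \<open>A\<^sub>s\<close> is a product of \<open>s\<close> forms \<open>L\<close> with
  \<open>A\<^sub>s | A\<^sub>s\<^sub>+\<^sub>1\<close> and \<open>B\<^sub>s\<close> is a product of \<open>\<alpha>\<^sub>s\<^sub>+\<^sub>1\<close> forms \<open>M\<close> with \<open>B\<^sub>s\<^sub>+\<^sub>1 | B\<^sub>s\<close>. Since the two kinds of factors
  are coprime, the syzygies are generated freely by those between consecutive corners of this staircase.

  The Cohen-Macaulay property forces comparability: the dimension is at least 2, so there is a regular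
  sequence of length 2 in the maximal ideal, and every section of \<open>R/I\<^sub>Z\<close> over the punctured spectrum lifts
  to a polynomial. For incomparable rows \<open>w\<close>, \<open>w'\<close> whose componentwise minimum \<open>v\<close> has least size, a form
  \<open>F\<close> of \<open>y\<close>-degree \<open>|v|\<close> supported on the row of \<open>w\<close> and extended by zero is such a section; comparing
  bidegrees, a polynomial that represents it is divisible by more forms \<open>L\<close> than its degree allows.
\<close>

section \<open>Ideals and prime elements\<close>

lemma prime_elem_power_dvd_mult_cancel:
  fixes p a b :: "'a::idom"
  assumes "prime_elem p" "\<not> p dvd a" "p ^ n dvd a * b"
  shows "p ^ n dvd b"
  using assms(3)
proof (induction n arbitrary: b)
  case (Suc n)
  have "p dvd p ^ Suc n" by simp
  with Suc.prems have "p dvd a * b" by (rule dvd_trans[rotated])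
  with assms(1,2) have "p dvd b" using prime_elem_dvd_multD by blast
  then obtain c where c: "b = p * c" by blast
  have "p * p ^ n dvd p * (a * c)" using Suc.prems c by (simp add: ac_simps)
  hence "p ^ n dvd a * c" using assms(1) by (auto simp: prime_elem_def)
  from Suc.IH[OF this] show ?case using c by simp
qed simp

lemma prime_elem_dvd_prod:
  fixes p :: "'a::idom"
  assumes "prime_elem p" "finite S" "p dvd (\<Prod>j\<in>S. b j)"
  obtains j where "j \<in> S" "p dvd b j"
  using assms(2,3,1)
  by (induction S arbitrary: thesis rule: finite_induct)
    (auto simp: prime_elem_not_unit prime_elem_dvd_mult_iff)

text \<open>The prime powers are split off one at a time: \<open>b j\<close> divides no other
  \<open>b l\<close>, hence not their product, so its power must divide the remaining
  cofactor.\<close>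

lemma prod_prime_powers_dvd:
  fixes b :: "'b \<Rightarrow> 'a::idom"
  assumes "finite S" "\<And>j. j \<in> S \<Longrightarrow> prime_elem (b j)"
    "\<And>j j'. j \<in> S \<Longrightarrow> j' \<in> S \<Longrightarrow> j \<noteq> j' \<Longrightarrow> \<not> b j dvd b j'"
    "\<And>j. j \<in> S \<Longrightarrow> b j ^ n j dvd x"
  shows "(\<Prod>j\<in>S. b j ^ n j) dvd x"
  using assms
proof (induction S rule: finite_induct)
  case (insert j S)
  have "(\<Prod>j\<in>S. b j ^ n j) dvd x" using insert by auto
  then obtain y where y: "x = (\<Prod>j\<in>S. b j ^ n j) * y" by blast
  have pj: "prime_elem (b j)" using insert by auto
  have "\<not> b j dvd (\<Prod>j\<in>S. b j ^ n j)"
  proof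
    assume "b j dvd (\<Prod>j\<in>S. b j ^ n j)"
    then obtain l where "l \<in> S" "b j dvd b l ^ n l"
      using pj insert.hyps(1) by (rule_tac prime_elem_dvd_prod)
    moreover from this have "b j dvd b l" using pj prime_elem_dvd_power by blast
    ultimately show False using insert by (metis insert_iff)
  qed
  moreover have "b j ^ n j dvd (\<Prod>j\<in>S. b j ^ n j) * y" using insert.prems(3)[of j] y by simp
  ultimately have "b j ^ n j dvd y" using pj prime_elem_power_dvd_mult_cancel by blast
  then show ?case using y insert.hyps by (auto simp: mult_dvd_mono mult.commute)
qed simp

text \<open>Modulo \<open>c\<close>, each \<open>b j\<close> divides \<open>a\<close>; multiplying
  these congruences gives the claim.\<close>

lemma power_eq_combination_prod:
  fixes a c :: "'a::comm_ring_1"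
  assumes "finite S" "\<And>j. j \<in> S \<Longrightarrow> \<exists>s t. a = s * b j + t * c"
  shows "\<exists>s t. a ^ card S = s * (\<Prod>j\<in>S. b j) + t * c"
  using assms
proof (induction S rule: finite_induct)
  case empty
  show ?case by (rule exI[of _ 1], rule exI[of _ 0]) simp
next
  case (insert j S)
  obtain s t where 1: "a ^ card S = s * (\<Prod>j\<in>S. b j) + t * c" using insert by auto
  obtain s' t' where 2: "a = s' * b j + t' * c" using insert.prems[of j] by auto
  have "a ^ card (insert j S) = (s' * b j + t' * c) * (s * (\<Prod>j\<in>S. b j) + t * c)"
    using 1 2 insert.hyps by simp
  also have "\<dots> = (s' * s) * (b j * (\<Prod>j\<in>S. b j))
      + (t' * s * (\<Prod>j\<in>S. b j) + s' * b j * t + t' * t * c) * c"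
    by (simp add: algebra_simps)
  finally show ?case using insert.hyps by auto
qed

text \<open>The exponent \<open>n * n\<close> comes from applying the product version twice: first
  \<open>b\<close> is replaced by \<open>b ^ n\<close>, then, with the roles exchanged,
  \<open>c\<close> by \<open>c ^ n\<close>.\<close>

lemma power_eq_combination_powers:
  fixes a b c :: "'a::comm_ring_1"
  assumes "a = s * b + t * c"
  shows "\<exists>s t. a ^ (n * n) = s * b ^ n + t * c ^ n"
proof -
  obtain s t where 1: "a ^ n = s * b ^ n + t * c"
    using power_eq_combination_prod[of "{..<n}" a "\<lambda>_. b" c] assms by auto
  hence "a ^ n = t * c + s * b ^ n" by (simp add: ac_simps)
  hence "\<exists>s t. (a ^ n) ^ n = s * c ^ n + t * b ^ n"
    using power_eq_combination_prod[of "{..<n}" "a ^ n" "\<lambda>_. c" "b ^ n"] by auto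
  then show ?thesis by (metis power_mult add.commute)
qed

section \<open>Ideals and their generators\<close>

lemma ideal_zero: "is_ideal I \<Longrightarrow> 0 \<in> I"
  and ideal_add: "is_ideal I \<Longrightarrow> a \<in> I \<Longrightarrow> b \<in> I \<Longrightarrow> a + b \<in> I"
  and ideal_mult_left: "is_ideal I \<Longrightarrow> a \<in> I \<Longrightarrow> c * a \<in> I"
  by (auto simp: is_ideal_def)

lemma ideal_dvd: "is_ideal I \<Longrightarrow> a \<in> I \<Longrightarrow> a dvd b \<Longrightarrow> b \<in> I"
  by (metis dvdE ideal_mult_left mult.commute)

lemma ideal_diff: "is_ideal I \<Longrightarrow> a \<in> I \<Longrightarrow> b \<in> I \<Longrightarrow> a - b \<in> I"
  using ideal_add[of I a "-1 * b"] ideal_mult_left[of I b "-1"] by simp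

lemma ideal_sum: "is_ideal I \<Longrightarrow> (\<And>x. x \<in> S \<Longrightarrow> f x \<in> I) \<Longrightarrow> sum f S \<in> I"
  by (induction S rule: infinite_finite_induct) (auto intro: ideal_zero ideal_add)

lemma is_ideal_ideal_gen: "is_ideal (ideal_gen G)"
  unfolding is_ideal_def
proof (intro conjI ballI allI)
  show "0 \<in> ideal_gen G"
    unfolding ideal_gen_def by (auto intro!: exI[of _ "{}"])
next
  fix a b assume "a \<in> ideal_gen G" "b \<in> ideal_gen G"
  then obtain S c S' c' where 1: "finite S" "S \<subseteq> G" "a = (\<Sum>g\<in>S. c g * g)"
    "finite S'" "S' \<subseteq> G" "b = (\<Sum>g\<in>S'. c' g * g)" unfolding ideal_gen_def by blast
  have "a = (\<Sum>g\<in>S \<union> S'. (if g \<in> S then c g else 0) * g)"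
    using 1 by (auto intro!: sum.mono_neutral_cong_left)
  moreover have "b = (\<Sum>g\<in>S \<union> S'. (if g \<in> S' then c' g else 0) * g)"
    using 1 by (auto intro!: sum.mono_neutral_cong_left)
  ultimately have "a + b = (\<Sum>g\<in>S \<union> S'. ((if g \<in> S then c g else 0) + (if g \<in> S' then c' g else 0)) * g)"
    by (simp add: sum.distrib distrib_right)
  with 1 show "a + b \<in> ideal_gen G" unfolding ideal_gen_def
    by (intro CollectI exI[of _ "S \<union> S'"] exI[of _ "\<lambda>g. (if g \<in> S then c g else 0) + (if g \<in> S' then c' g else 0)"]) auto
next
  fix r a assume "a \<in> ideal_gen G"
  then obtain S c where 1: "finite S" "S \<subseteq> G" "a = (\<Sum>g\<in>S. c g * g)" unfolding ideal_gen_def by blast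
  then have "r * a = (\<Sum>g\<in>S. (r * c g) * g)" by (simp add: sum_distrib_left mult.assoc)
  with 1 show "r * a \<in> ideal_gen G" unfolding ideal_gen_def
    by (intro CollectI exI[of _ S] exI[of _ "\<lambda>g. r * c g"]) auto
qed

lemma ideal_gen_superset: "G \<subseteq> ideal_gen G"
proof
  fix g assume "g \<in> G"
  thus "g \<in> ideal_gen G" unfolding ideal_gen_def
    by (intro CollectI exI[of _ "{g}"] exI[of _ "\<lambda>_. 1"]) auto
qed

lemma ideal_gen_least: "is_ideal I \<Longrightarrow> G \<subseteq> I \<Longrightarrow> ideal_gen G \<subseteq> I"
  by (auto simp: ideal_gen_def intro!: ideal_sum ideal_mult_left)

lemma ideal_gen_ideal: "is_ideal I \<Longrightarrow> ideal_gen I = I"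
  using ideal_gen_least[of I I] ideal_gen_superset[of I] by blast

text \<open>Puts the condition on the second member of a regular sequence in terms of explicit
  multiples of the first.\<close>

lemma mem_ideal_gen_insert:
  assumes "is_ideal I"
  shows "x \<in> ideal_gen (I \<union> {f}) \<longleftrightarrow> (\<exists>a. x - a * f \<in> I)"
proof -
  have id: "is_ideal {x. \<exists>a. x - a * f \<in> I}"
    unfolding is_ideal_def
  proof (intro conjI ballI allI; clarsimp)
    show "\<exists>a. - (a * f) \<in> I" using ideal_zero[OF assms] by (intro exI[of _ 0]) simp
    show "\<exists>a. x + y - a * f \<in> I" if "x - a * f \<in> I" "y - b * f \<in> I" for x y a b
      using ideal_add[OF assms that] by (intro exI[of _ "a + b"]) (simp add: algebra_simps)
    show "\<exists>a. r * x - a * f \<in> I" if "x - a * f \<in> I" for x a r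
      using ideal_mult_left[OF assms that, of r] by (intro exI[of _ "r * a"]) (simp add: algebra_simps)
  qed
  have "I \<union> {f} \<subseteq> {x. \<exists>a. x - a * f \<in> I}"
    using ideal_zero[OF assms] by (auto intro: exI[of _ 0] exI[of _ 1])
  from ideal_gen_least[OF id this]
  have "x \<in> ideal_gen (I \<union> {f}) \<Longrightarrow> \<exists>a. x - a * f \<in> I" by auto
  moreover have "x \<in> ideal_gen (I \<union> {f})" if "x - a * f \<in> I" for a
  proof -
    have "x - a * f \<in> ideal_gen (I \<union> {f})" "f \<in> ideal_gen (I \<union> {f})"
      using that ideal_gen_superset[of "I \<union> {f}"] by auto
    from ideal_add[OF is_ideal_ideal_gen this(1) ideal_mult_left[OF is_ideal_ideal_gen this(2), of a]]
    show ?thesis by simp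
  qed
  ultimately show ?thesis by blast
qed

text \<open>The power \<open>(l, m)\<^sup>n\<close>, described through its expansion in powers of \<open>l\<close>.\<close>
fun pw :: "'a::comm_ring_1 \<Rightarrow> 'a \<Rightarrow> nat \<Rightarrow> 'a set" where
  "pw l m 0 = UNIV"
| "pw l m (Suc n) = {c * m ^ Suc n + l * q | c q. q \<in> pw l m n}"

declare pw.simps(2) [simp del]

lemma pw_SucI: "p = c * m ^ Suc n + l * q \<Longrightarrow> q \<in> pw l m n \<Longrightarrow> p \<in> pw l m (Suc n)"
  unfolding pw.simps(2) by blast

lemma pw_SucE:
  assumes "p \<in> pw l m (Suc n)"
  obtains c q where "p = c * m ^ Suc n + l * q" "q \<in> pw l m n"
  using assms by (auto simp: pw.simps(2))

lemma is_ideal_pw: "is_ideal (pw l m n)"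
proof (induction n)
  case 0 show ?case by (simp add: is_ideal_def)
next
  case (Suc n)
  show ?case unfolding is_ideal_def
  proof (intro conjI ballI allI)
    show "0 \<in> pw l m (Suc n)" by (rule pw_SucI[of _ 0 _ _ _ 0]) (use ideal_zero[OF Suc] in auto)
  next
    fix a b assume "a \<in> pw l m (Suc n)" "b \<in> pw l m (Suc n)"
    then obtain c q c' q' where "a = c * m ^ Suc n + l * q" "b = c' * m ^ Suc n + l * q'"
      "q \<in> pw l m n" "q' \<in> pw l m n" by (auto elim!: pw_SucE)
    then show "a + b \<in> pw l m (Suc n)" using ideal_add[OF Suc, of q q']
      by (intro pw_SucI[of _ "c + c'" _ _ _ "q + q'"]) (auto simp: algebra_simps)
  next
    fix r a assume "a \<in> pw l m (Suc n)"
    then obtain c q where "a = c * m ^ Suc n + l * q" "q \<in> pw l m n" by (auto elim: pw_SucE)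
    then show "r * a \<in> pw l m (Suc n)" using ideal_mult_left[OF Suc, of q r]
      by (intro pw_SucI[of _ "r * c" _ _ _ "r * q"]) (auto simp: algebra_simps)
  qed
qed

lemma pw_mult_left: "q \<in> pw l m n \<Longrightarrow> l * q \<in> pw l m (Suc n)"
  by (rule pw_SucI[of _ 0]) auto

lemma pw_mult_right: "q \<in> pw l m n \<Longrightarrow> m * q \<in> pw l m (Suc n)"
proof (induction n arbitrary: q)
  case 0 show ?case by (rule pw_SucI[of _ q _ _ _ 0]) auto
next
  case (Suc n)
  then obtain c q' where q: "q = c * m ^ Suc n + l * q'" "q' \<in> pw l m n" by (auto elim: pw_SucE)
  have "m * q' \<in> pw l m (Suc n)" using Suc.IH q by blast
  moreover have "m * q = c * m ^ Suc (Suc n) + l * (m * q')" using q by (simp add: algebra_simps)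
  ultimately show ?case by (rule pw_SucI[rotated])
qed

lemma pw_Suc_subset: "pw l m (Suc n) \<subseteq> pw l m n"
proof (induction n)
  case (Suc n)
  show ?case
  proof
    fix a assume "a \<in> pw l m (Suc (Suc n))"
    then obtain c q where "a = c * m ^ Suc (Suc n) + l * q" and q: "q \<in> pw l m (Suc n)"
      by (auto elim: pw_SucE)
    then have "a = (c * m) * m ^ Suc n + l * q" by (simp add: mult_ac)
    with Suc q show "a \<in> pw l m (Suc n)" by (blast intro: pw_SucI)
  qed
qed simp

lemma pw_antimono: "n \<le> n' \<Longrightarrow> pw l m n' \<subseteq> pw l m n"
  by (induction rule: dec_induct) (use pw_Suc_subset in blast)+

lemma pw_memI:
  assumes "n \<le> a + b" "l ^ a * m ^ b dvd p"
  shows "p \<in> pw l m n"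
proof -
  have "m ^ b \<in> pw l m b" by (induction b) (auto simp: pw_mult_right)
  hence "l ^ a * m ^ b \<in> pw l m (a + b)"
    by (induction a) (auto simp: pw_mult_left mult.assoc)
  thus ?thesis using assms pw_antimono ideal_dvd[OF is_ideal_pw] by blast
qed

text \<open>Among the monomials of degree \<open>Suc n\<close> in \<open>l\<close> and
  \<open>m\<close> only \<open>m ^ Suc n\<close> is not a multiple of \<open>l\<close>, so each step
  of \<open>pw\<close> needs just one free coefficient.\<close>

lemma ideal_pow_pair_eq_pw: "ideal_pow (ideal_gen {l, m}) n = pw l m n"
proof (induction n)
  case (Suc n)
  let ?G = "{a * b |a b. a \<in> ideal_gen {l, m} \<and> b \<in> pw l m n}"
  have "a * b \<in> pw l m (Suc n)" if "a \<in> ideal_gen {l, m}" "b \<in> pw l m n" for a b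
  proof -
    have "is_ideal {a. a * b \<in> pw l m (Suc n)}"
      using is_ideal_pw[of l m "Suc n"]
      by (auto simp: is_ideal_def distrib_right mult.assoc)
    moreover have "{l, m} \<subseteq> {a. a * b \<in> pw l m (Suc n)}"
      using that by (simp add: pw_mult_left pw_mult_right)
    ultimately have "ideal_gen {l, m} \<subseteq> {a. a * b \<in> pw l m (Suc n)}" by (rule ideal_gen_least)
    thus ?thesis using that(1) by auto
  qed
  hence "ideal_gen ?G \<subseteq> pw l m (Suc n)" by (intro ideal_gen_least is_ideal_pw) blast
  moreover have "pw l m (Suc n) \<subseteq> ideal_gen ?G"
  proof
    fix a assume "a \<in> pw l m (Suc n)"
    then obtain c q where a: "a = c * m ^ Suc n + l * q" "q \<in> pw l m n" by (auto elim: pw_SucE)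
    have "l \<in> ideal_gen {l, m}" "m \<in> ideal_gen {l, m}" using ideal_gen_superset[of "{l, m}"] by auto
    moreover have "m ^ n \<in> pw l m n" by (rule pw_memI[of _ 0 n]) auto
    ultimately have "l * q \<in> ?G" "m * m ^ n \<in> ?G" using a(2) by blast+
    hence "l * q \<in> ideal_gen ?G" "m * m ^ n \<in> ideal_gen ?G"
      using ideal_gen_superset[of ?G] by (auto simp only: subset_iff)
    note gens = this
    show "a \<in> ideal_gen ?G" unfolding a(1) power_Suc
      by (rule ideal_add[OF is_ideal_ideal_gen ideal_mult_left[OF is_ideal_ideal_gen gens(2)] gens(1)])
  qed
  ultimately show ?case using Suc by (simp add: ideal_mult_def)
qed simp

section \<open>Grids of linear forms\<close>

text \<open>The map \<open>\<sigma> i\<close> is a ring endomorphism that kills \<open>L i\<close>,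
  fixes every \<open>M j\<close> and is congruent to the identity modulo \<open>L i\<close>. It
  stands for reduction modulo \<open>L i\<close> without leaving the ring.\<close>

locale grid =
  fixes r t :: nat and L M :: "nat \<Rightarrow> 'a::idom" and \<sigma> :: "nat \<Rightarrow> 'a \<Rightarrow> 'a"
  assumes prime_L: "i < r \<Longrightarrow> prime_elem (L i)"
    and prime_M: "j < t \<Longrightarrow> prime_elem (M j)"
    and L_ndvd_L: "i < r \<Longrightarrow> i' < r \<Longrightarrow> i \<noteq> i' \<Longrightarrow> \<not> L i dvd L i'"
    and M_ndvd_M: "j < t \<Longrightarrow> j' < t \<Longrightarrow> j \<noteq> j' \<Longrightarrow> \<not> M j dvd M j'"
    and M_ndvd_L: "j < t \<Longrightarrow> i < r \<Longrightarrow> \<not> M j dvd L i"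
    and \<sigma>_add: "i < r \<Longrightarrow> \<sigma> i (a + b) = \<sigma> i a + \<sigma> i b"
    and \<sigma>_mult: "i < r \<Longrightarrow> \<sigma> i (a * b) = \<sigma> i a * \<sigma> i b"
    and \<sigma>_one: "i < r \<Longrightarrow> \<sigma> i 1 = 1"
    and \<sigma>_L: "i < r \<Longrightarrow> \<sigma> i (L i) = 0"
    and \<sigma>_M: "i < r \<Longrightarrow> j < t \<Longrightarrow> \<sigma> i (M j) = M j"
    and L_dvd_diff_\<sigma>: "i < r \<Longrightarrow> L i dvd p - \<sigma> i p"
    and M_ndvd_\<sigma>_L: "i < r \<Longrightarrow> i' < r \<Longrightarrow> i \<noteq> i' \<Longrightarrow> j < t \<Longrightarrow> \<not> M j dvd \<sigma> i (L i')"
begin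

lemma \<sigma>_M_power: "i < r \<Longrightarrow> j < t \<Longrightarrow> \<sigma> i (M j ^ n) = M j ^ n"
  by (induction n) (auto simp: \<sigma>_one \<sigma>_mult \<sigma>_M)

lemma \<sigma>_eq_0: "i < r \<Longrightarrow> L i dvd p \<Longrightarrow> \<sigma> i p = 0"
  by (auto simp: \<sigma>_mult \<sigma>_L)

lemma L_nonzero: "i < r \<Longrightarrow> L i \<noteq> 0"
  using prime_L by (auto simp: prime_elem_def)

lemma M_nonzero: "j < t \<Longrightarrow> M j \<noteq> 0"
  using prime_M by (auto simp: prime_elem_def)

lemma L_ndvd_M: "i < r \<Longrightarrow> j < t \<Longrightarrow> \<not> L i dvd M j"
  using \<sigma>_eq_0 \<sigma>_M M_nonzero by metis

lemma L_ndvd_prod_M: "i < r \<Longrightarrow> \<not> L i dvd (\<Prod>j<t. M j ^ n j)"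
  using prime_elem_dvd_prod[OF prime_L, of i "{..<t}" "\<lambda>j. M j ^ n j"] L_ndvd_M prime_L prime_elem_dvd_power
  by (metis finite_lessThan lessThan_iff)

text \<open>In the expansion of \<open>L i * f\<close>, the coefficient of the pure power of
  \<open>M j\<close> must be divisible by the prime \<open>L i\<close>, which does not divide
  \<open>M j\<close>; one factor \<open>L i\<close> then cancels.\<close>

lemma pw_cancel_L:
  assumes "i < r" "j < t" "L i * f \<in> pw (L i) (M j) n"
  shows "f \<in> pw (L i) (M j) (n - 1)"
proof (cases n)
  case (Suc n')
  then obtain c q where q: "L i * f = c * M j ^ Suc n' + L i * q" "q \<in> pw (L i) (M j) n'"
    using assms(3) by (auto elim: pw_SucE)
  hence "L i * (f - q) = c * M j ^ Suc n'" by (simp add: algebra_simps)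
  hence "L i dvd c * M j ^ Suc n'" by (metis dvd_triv_left)
  hence "L i dvd c" using prime_L assms L_ndvd_M prime_elem_dvd_multD prime_elem_dvd_power by metis
  then obtain c' where "c = L i * c'" by blast
  with q have "L i * f = L i * (c' * M j ^ Suc n' + q)" by (simp add: algebra_simps)
  hence "f = c' * M j ^ Suc n' + q" using L_nonzero assms(1) by simp
  moreover have "c' * M j ^ Suc n' \<in> pw (L i) (M j) n'" by (rule pw_memI[of _ 0 "Suc n'"]) auto
  ultimately show ?thesis using q Suc ideal_add[OF is_ideal_pw] by simp
qed simp

lemma M_power_dvd_\<sigma>:
  assumes "i < r" "j < t" "f \<in> pw (L i) (M j) n"
  shows "M j ^ n dvd \<sigma> i f"
  using assms by (cases n) (auto elim!: pw_SucE simp: \<sigma>_add \<sigma>_mult \<sigma>_L \<sigma>_M \<sigma>_M_power)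

lemma \<sigma>_dvdD:
  assumes "i < r" "N dvd \<sigma> i f"
  obtains c q where "f = c * N + L i * q"
proof -
  obtain q where "f - \<sigma> i f = L i * q" using L_dvd_diff_\<sigma>[OF assms(1)] by blast
  moreover obtain c where "\<sigma> i f = N * c" using assms(2) by blast
  ultimately have "f = c * N + L i * q" by (simp add: algebra_simps)
  thus ?thesis using that by blast
qed

text \<open>\<open>M j\<close> does not divide the image of \<open>L i'\<close> under
  \<open>\<sigma> i\<close>, so the power of \<open>M j\<close> divides the image of
  \<open>f\<close>. What remains of \<open>f\<close> is a multiple of \<open>L i\<close>, whose
  cofactor falls under the induction hypothesis.\<close>

lemma pw_cancel_other_L:
  assumes "i < r" "j < t" "i' < r" "i \<noteq> i'" "L i' * f \<in> pw (L i) (M j) n"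
  shows "f \<in> pw (L i) (M j) n"
  using assms(5)
proof (induction n arbitrary: f)
  case (Suc n)
  have "M j ^ Suc n dvd \<sigma> i (L i') * \<sigma> i f"
    using M_power_dvd_\<sigma>[OF assms(1,2) Suc.prems] assms(1) by (simp add: \<sigma>_mult)
  hence "M j ^ Suc n dvd \<sigma> i f"
    using prime_elem_power_dvd_mult_cancel[OF prime_M M_ndvd_\<sigma>_L] assms by blast
  then obtain c q where f: "f = c * M j ^ Suc n + L i * q" using \<sigma>_dvdD assms(1) by blast
  have "L i' * f - (L i' * c) * M j ^ Suc n \<in> pw (L i) (M j) (Suc n)"
    by (rule ideal_diff[OF is_ideal_pw Suc.prems pw_memI[of _ 0 "Suc n"]]) auto
  moreover have "L i' * f - (L i' * c) * M j ^ Suc n = L i * (L i' * q)"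
    unfolding f by (simp add: algebra_simps)
  ultimately have "L i' * q \<in> pw (L i) (M j) n" using pw_cancel_L[OF assms(1,2)] by (metis diff_Suc_1)
  hence "q \<in> pw (L i) (M j) n" by (rule Suc.IH)
  thus ?case using f by (rule_tac pw_SucI)
qed simp

section \<open>Ideals of the fat points on one line and on the whole grid\<close>

definition row :: "nat \<Rightarrow> (nat \<Rightarrow> nat) \<Rightarrow> 'a set" where
  "row i w = {p. \<forall>j<t. p \<in> pw (L i) (M j) (w j)}"

definition fat :: "(nat \<Rightarrow> nat \<Rightarrow> nat) \<Rightarrow> 'a set" where
  "fat \<mu> = {p. \<forall>i<r. p \<in> row i (\<mu> i)}"

definition MM :: "(nat \<Rightarrow> nat) \<Rightarrow> 'a" where
  "MM w = (\<Prod>j<t. M j ^ w j)"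

lemma is_ideal_row: "is_ideal (row i w)"
  using is_ideal_pw[of "L i"] by (auto simp: is_ideal_def row_def)

lemma is_ideal_fat: "is_ideal (fat \<mu>)"
  using is_ideal_row by (auto simp: is_ideal_def fat_def)

lemma row_memI:
  assumes "L i ^ a * MM u dvd p" "\<And>j. j < t \<Longrightarrow> w j \<le> a + u j"
  shows "p \<in> row i w"
  unfolding row_def
proof (safe)
  fix j assume j: "j < t"
  have "M j ^ u j dvd MM u" unfolding MM_def using j by (intro dvd_prodI) auto
  hence "L i ^ a * M j ^ u j dvd p" using assms(1) by (meson dvd_trans mult_dvd_mono dvd_refl)
  thus "p \<in> pw (L i) (M j) (w j)" using assms(2)[OF j] by (rule_tac pw_memI)
qed

lemma row_cancel_L:
  "i < r \<Longrightarrow> L i * f \<in> row i w \<Longrightarrow> f \<in> row i (\<lambda>j. w j - 1)"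
  by (auto simp: row_def dest!: pw_cancel_L)

lemma row_cancel_other_L:
  "i < r \<Longrightarrow> i' < r \<Longrightarrow> i \<noteq> i' \<Longrightarrow> L i' * f \<in> row i w \<Longrightarrow> f \<in> row i w"
  by (auto simp: row_def dest: pw_cancel_other_L)

text \<open>Reduced modulo \<open>L i\<close>, an element of the row is divisible by every
  \<open>M j ^ w j\<close>, hence by their product. Lifting back leaves a multiple of
  \<open>L i\<close>, and cancelling \<open>L i\<close> lowers each exponent by one.\<close>

lemma row_decomp:
  assumes "i < r" "f \<in> row i w"
  obtains c q where "f = c * MM w + L i * q" "q \<in> row i (\<lambda>j. w j - 1)"
proof -
  have "MM w dvd \<sigma> i f" unfolding MM_def
    by (rule prod_prime_powers_dvd) (use assms prime_M M_ndvd_M M_power_dvd_\<sigma> in \<open>auto simp: row_def\<close>)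
  then obtain c q where f: "f = c * MM w + L i * q" using \<sigma>_dvdD assms(1) by blast
  have "c * MM w \<in> row i w" by (rule row_memI[of _ 0 w]) auto
  from ideal_diff[OF is_ideal_row assms(2) this] have "L i * q \<in> row i w" using f by simp
  thus ?thesis using that f row_cancel_L[OF assms(1)] by blast
qed

end

section \<open>Peeling off the largest row\<close>

context grid
begin

text \<open>All shifts are allowed, also those that make a row zero, so the condition survives when
  one row is lowered by one.\<close>

definition comparable_rows :: "(nat \<Rightarrow> nat \<Rightarrow> nat) \<Rightarrow> bool" where
  "comparable_rows \<mu> \<longleftrightarrow> (\<forall>i<r. \<forall>i'<r. \<forall>k k'.
     (\<forall>j<t. \<mu> i j - k \<le> \<mu> i' j - k') \<or> (\<forall>j<t. \<mu> i' j - k' \<le> \<mu> i j - k))"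

text \<open>The list records pairs of a line index and a row in the order of peeling. The first
  \<open>s\<close> lines are multiplied with the forms of the row that comes next; after the last
  row that factor is 1.\<close>

definition gen :: "(nat \<times> (nat \<Rightarrow> nat)) list \<Rightarrow> nat \<Rightarrow> 'a" where
  "gen ps s = (\<Prod>p<s. L (fst (ps ! p))) * (if s < length ps then MM (snd (ps ! s)) else 1)"

lemma gen_Cons_0: "gen (x # ps) 0 = MM (snd x)"
  by (simp add: gen_def)

lemma gen_Cons_Suc: "gen (x # ps) (Suc s) = L (fst x) * gen ps s"
  by (simp add: gen_def prod.lessThan_Suc_shift mult.assoc del: prod.lessThan_Suc)

text \<open>A row with the largest sum works: a comparable row exceeding it in one column would have
  a larger sum.\<close>

lemma maximal_row_exists:
  assumes "comparable_rows \<mu>" "0 < r"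
  obtains i0 where "i0 < r" "\<And>i j. i < r \<Longrightarrow> j < t \<Longrightarrow> \<mu> i j \<le> \<mu> i0 j"
proof -
  let ?s = "\<lambda>i. \<Sum>j<t. \<mu> i j"
  have "Max (?s ` {..<r}) \<in> ?s ` {..<r}" using assms(2) by (intro Max_in) auto
  then obtain i0 where i0: "i0 < r" "?s i0 = Max (?s ` {..<r})" by auto
  have "\<mu> i j \<le> \<mu> i0 j" if ij: "i < r" "j < t" for i j
  proof (rule ccontr)
    assume neg: "\<not> \<mu> i j \<le> \<mu> i0 j"
    have "(\<forall>j<t. \<mu> i j - 0 \<le> \<mu> i0 j - 0) \<or> (\<forall>j<t. \<mu> i0 j - 0 \<le> \<mu> i j - 0)"
      using assms(1) ij(1) i0(1) unfolding comparable_rows_def by blast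
    with neg ij(2) have "\<forall>j<t. \<mu> i0 j \<le> \<mu> i j" by auto
    hence "?s i0 < ?s i" using neg ij(2) by (intro sum_strict_mono_ex1) (auto simp: not_le intro!: bexI[of _ j])
    moreover have "?s i \<le> ?s i0" unfolding i0(2) using ij by (intro Max_ge) auto
    ultimately show False by simp
  qed
  with i0(1) that show ?thesis by blast
qed

text \<open>Lowering a nonzero row by one removes its entry for \<open>k = 0\<close>, the full sum,
  and renumbers the others. The maximum is positive, so truncated subtraction shortens the list by
  exactly one.\<close>

lemma mset_row_entries_peel:
  assumes "j < t" "0 < w j"
  shows "mset (map (a_Z t (\<lambda>_. w) i) [0..<l_Z t (\<lambda>_. w) i]) =
    add_mset (\<Sum>j<t. w j) (mset (map (a_Z t (\<lambda>_ j. w j - 1) i) [0..<l_Z t (\<lambda>_ j. w j - 1) i]))"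
proof -
  let ?l = "l_Z t (\<lambda>_ j. w j - 1) i"
  have ne: "w ` {..<t} \<noteq> {}" using assms by auto
  have "Max (w ` {..<t}) - 1 = Max ((\<lambda>n. n - 1) ` w ` {..<t})"
    by (rule mono_Max_commute) (use ne in \<open>auto simp: mono_def\<close>)
  moreover have "w j \<le> Max (w ` {..<t})" using assms by auto
  ultimately have "Max (w ` {..<t}) = Suc (Max ((\<lambda>n. n - 1) ` w ` {..<t}))"
    using assms(2) by linarith
  then have l: "l_Z t (\<lambda>_. w) i = Suc ?l" by (simp add: l_Z_def image_image)
  have "[0..<Suc ?l] = 0 # map Suc [0..<?l]" by (simp add: upt_conv_Cons map_Suc_upt del: upt_Suc)
  moreover have "a_Z t (\<lambda>_. w) i (Suc k) = a_Z t (\<lambda>_ j. w j - 1) i k" for k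
    by (simp add: a_Z_def)
  ultimately show ?thesis unfolding l by (simp add: a_Z_def[abs_def] comp_def del: upt_Suc)
qed

text \<open>Induction on the total multiplicity: the largest row is recorded at the head of the list
  and its line lowered by one. The bound by an arbitrary \<open>v\<close> is carried along to
  compare the head with the rows that follow.\<close>

lemma fat_peel_generators:
  assumes "comparable_rows \<mu>" "0 < t"
  shows "\<exists>ps. (\<forall>x\<in>set ps. fst x < r) \<and>
    (\<forall>s. Suc s < length ps \<longrightarrow> (\<forall>j<t. snd (ps ! Suc s) j \<le> snd (ps ! s) j)) \<and>
    (\<forall>v. (\<forall>i<r. \<forall>j<t. \<mu> i j \<le> v j) \<longrightarrow> (\<forall>x\<in>set ps. \<forall>j<t. snd x j \<le> v j)) \<and>
    (\<forall>x\<in>set ps. 0 < (\<Sum>j<t. snd x j)) \<and>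
    mset (map (\<lambda>x. \<Sum>j<t. snd x j) ps) = (\<Sum>i<r. mset (map (a_Z t \<mu> i) [0..<l_Z t \<mu> i])) \<and>
    (\<forall>f\<in>fat \<mu>. \<exists>c. f = (\<Sum>s\<le>length ps. c s * gen ps s)) \<and>
    (\<forall>s\<le>length ps. gen ps s \<in> fat \<mu>)"
  using assms(1)
proof (induction "\<Sum>i<r. \<Sum>j<t. \<mu> i j" arbitrary: \<mu> rule: less_induct)
  case less
  show ?case
  proof (cases "\<exists>i<r. \<exists>j<t. 0 < \<mu> i j")
    case False
    hence z: "\<mu> i j = 0" if "i < r" "j < t" for i j using that by auto
    have "\<mu> i ` {..<t} = {0}" if "i < r" for i
      using z that \<open>0 < t\<close> by (auto simp: image_iff)
    hence "l_Z t \<mu> i = 0" if "i < r" for i using that by (simp add: l_Z_def)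
    hence "(\<Sum>i<r. mset (map (a_Z t \<mu> i) [0..<l_Z t \<mu> i])) = {#}" by simp
    \<comment> \<open>Without points the ideal is the whole ring, and the empty list contributes the
      generator 1.\<close>
    moreover have "gen [] 0 = 1" by (simp add: gen_def)
    moreover have "x \<in> fat \<mu>" for x using z by (auto simp: fat_def row_def)
    ultimately show ?thesis by (intro exI[of _ "[]"]) auto
  next
    case True
    hence "0 < r" by auto
    with less.prems obtain i0 where i0: "i0 < r" and
      mx: "\<And>i j. i < r \<Longrightarrow> j < t \<Longrightarrow> \<mu> i j \<le> \<mu> i0 j" using maximal_row_exists by blast
    obtain j0 where j0: "j0 < t" "0 < \<mu> i0 j0" using True mx by (meson less_le_trans)
    define \<mu>' where "\<mu>' = \<mu>(i0 := \<lambda>j. \<mu> i0 j - 1)"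
    \<comment> \<open>A row of \<open>\<mu>'\<close> is a row of \<open>\<mu>\<close> with the shift
      at \<open>i0\<close> raised by one, so comparability is inherited.\<close>
    have lower: "\<mu>' i j - k = \<mu> i j - (k + (if i = i0 then 1 else 0))" for i j k
      by (simp add: \<mu>'_def)
    have "\<mu>' i j \<le> \<mu> i j" for i j by (simp add: \<mu>'_def)
    moreover have "\<mu>' i0 j0 < \<mu> i0 j0" using j0 by (simp add: \<mu>'_def)
    moreover from calculation have "(\<Sum>j<t. \<mu>' i0 j) < (\<Sum>j<t. \<mu> i0 j)"
      using j0 by (intro sum_strict_mono_ex1) auto
    ultimately have less_sum: "(\<Sum>i<r. \<Sum>j<t. \<mu>' i j) < (\<Sum>i<r. \<Sum>j<t. \<mu> i j)"
      using i0 by (intro sum_strict_mono_ex1) (auto intro!: sum_mono)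
    have cmp: "comparable_rows \<mu>'"
      using less.prems unfolding comparable_rows_def lower by blast
    obtain ps where ps: "\<forall>x\<in>set ps. fst x < r"
      "\<forall>s. Suc s < length ps \<longrightarrow> (\<forall>j<t. snd (ps ! Suc s) j \<le> snd (ps ! s) j)"
      "\<forall>v. (\<forall>i<r. \<forall>j<t. \<mu>' i j \<le> v j) \<longrightarrow> (\<forall>x\<in>set ps. \<forall>j<t. snd x j \<le> v j)"
      "\<forall>x\<in>set ps. 0 < (\<Sum>j<t. snd x j)"
      "mset (map (\<lambda>x. \<Sum>j<t. snd x j) ps) = (\<Sum>i<r. mset (map (a_Z t \<mu>' i) [0..<l_Z t \<mu>' i]))"
      "\<forall>f\<in>fat \<mu>'. \<exists>c. f = (\<Sum>s\<le>length ps. c s * gen ps s)"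
      "\<forall>s\<le>length ps. gen ps s \<in> fat \<mu>'"
      using less.hyps[OF less_sum cmp] by (elim exE conjE) (rule that)
    have le: "\<mu>' i j \<le> \<mu> i j" for i j by (simp add: \<mu>'_def)
    have ms: "(\<Sum>i<r. mset (map (a_Z t \<mu> i) [0..<l_Z t \<mu> i]))
      = add_mset (\<Sum>j<t. \<mu> i0 j) (\<Sum>i<r. mset (map (a_Z t \<mu>' i) [0..<l_Z t \<mu>' i]))"
    proof -
      let ?A = "\<lambda>\<mu> i. mset (map (a_Z t \<mu> i) [0..<l_Z t \<mu> i])"
      have dep: "?A m i = ?A m' i'" if "m i = m' i'" for m m' :: "nat \<Rightarrow> nat \<Rightarrow> nat" and i i'
        using that by (simp add: l_Z_def a_Z_def[abs_def])
      have "?A \<mu> i0 = add_mset (\<Sum>j<t. \<mu> i0 j) (?A \<mu>' i0)"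
        using mset_row_entries_peel[of j0 "\<mu> i0" i0] j0
          dep[of \<mu> i0 "\<lambda>_. \<mu> i0" i0] dep[of \<mu>' i0 "\<lambda>_ j. \<mu> i0 j - 1" i0]
        by (simp add: \<mu>'_def)
      moreover have "(\<Sum>i\<in>{..<r} - {i0}. ?A \<mu> i) = (\<Sum>i\<in>{..<r} - {i0}. ?A \<mu>' i)"
        by (rule sum.cong[OF refl], rule dep) (auto simp: \<mu>'_def)
      moreover have "sum F {..<r} = F i0 + sum F ({..<r} - {i0})" for F :: "nat \<Rightarrow> nat multiset"
        by (rule sum.remove) (use i0 in auto)
      ultimately show ?thesis by (simp only: union_mset_add_mset_left)
    qed
    have gen_up: "L i0 * q \<in> fat \<mu>" if "q \<in> fat \<mu>'" for q
      unfolding fat_def row_def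
    proof safe
      fix i j assume ij: "i < r" "j < t"
      from that ij have q: "q \<in> pw (L i) (M j) (\<mu>' i j)" by (auto simp: fat_def row_def)
      show "L i0 * q \<in> pw (L i) (M j) (\<mu> i j)"
      proof (cases "i = i0")
        case True
        show ?thesis
        proof (cases "\<mu> i j")
          case (Suc n)
          then show ?thesis using q True by (simp add: \<mu>'_def pw_mult_left)
        qed simp
      next
        case False
        thus ?thesis using q by (simp add: \<mu>'_def ideal_mult_left[OF is_ideal_pw])
      qed
    qed
    have MM_fat: "c * MM (\<mu> i0) \<in> row i (\<mu> i)" if "i < r" for c i
      by (rule row_memI[of _ 0 "\<mu> i0"]) (use mx that in auto)
    \<comment> \<open>On line \<open>i0\<close> this is \<open>row_decomp\<close>. On any other line
      \<open>MM (\<mu> i0)\<close> lies in the row because \<open>\<mu> i0\<close> dominates it;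
      subtracting leaves \<open>L i0 * q\<close>, and \<open>L i0\<close> cancels there.\<close>
    have decomp: "\<exists>c q. f = c * MM (\<mu> i0) + L i0 * q \<and> q \<in> fat \<mu>'" if f: "f \<in> fat \<mu>" for f
    proof -
      have "f \<in> row i0 (\<mu> i0)" using f i0 by (simp add: fat_def)
      then obtain c q where fq: "f = c * MM (\<mu> i0) + L i0 * q" and q0: "q \<in> row i0 (\<lambda>j. \<mu> i0 j - 1)"
        using row_decomp[OF i0] by blast
      have "q \<in> row i (\<mu>' i)" if i: "i < r" for i
      proof (cases "i = i0")
        case True then show ?thesis using q0 by (simp add: \<mu>'_def)
      next
        case False
        have "f - c * MM (\<mu> i0) \<in> row i (\<mu> i)"
          using f i by (intro ideal_diff is_ideal_row MM_fat) (auto simp: fat_def)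
        hence "L i0 * q \<in> row i (\<mu> i)" by (simp add: fq)
        then show ?thesis using row_cancel_other_L[of i i0] i i0 False by (simp add: \<mu>'_def)
      qed
      thus ?thesis using fq by (auto simp: fat_def)
    qed
    let ?ps = "(i0, \<mu> i0) # ps"
    have dec: "snd (?ps ! Suc s) j \<le> snd (?ps ! s) j" if "Suc s < length ?ps" "j < t" for s j
    proof (cases s)
      case 0
      have "\<forall>i<r. \<forall>j<t. \<mu>' i j \<le> \<mu> i0 j" using le mx by (meson le_trans)
      hence "\<forall>x\<in>set ps. \<forall>j<t. snd x j \<le> \<mu> i0 j" using ps(3) by blast
      moreover have "ps ! 0 \<in> set ps" using that 0 by (intro nth_mem) simp
      ultimately show ?thesis using that 0 by simp
    next
      case (Suc n) then show ?thesis using that ps(2) by simp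
    qed
    have bd: "\<forall>x\<in>set ?ps. \<forall>j<t. snd x j \<le> v j" if "\<forall>i<r. \<forall>j<t. \<mu> i j \<le> v j" for v
    proof -
      have "\<forall>i<r. \<forall>j<t. \<mu>' i j \<le> v j" using le that by (meson le_trans)
      thus ?thesis using ps(3) that i0 by auto
    qed
    have pos: "0 < (\<Sum>j<t. \<mu> i0 j)" using j0 by (auto intro!: sum_pos2[of _ j0])
    have gens: "\<exists>c. f = (\<Sum>s\<le>length ?ps. c s * gen ?ps s)" if fm: "f \<in> fat \<mu>" for f
    proof -
      obtain c q where f: "f = c * MM (\<mu> i0) + L i0 * q" "q \<in> fat \<mu>'" using decomp[OF fm] by blast
      obtain c' where q: "q = (\<Sum>s\<le>length ps. c' s * gen ps s)" using ps(6) f(2) by blast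
      have "f = (\<Sum>s\<le>length ?ps. (case s of 0 \<Rightarrow> c | Suc s \<Rightarrow> c' s) * gen ?ps s)"
        unfolding f(1) q
        by (simp add: sum.atMost_Suc_shift gen_Cons_0 gen_Cons_Suc sum_distrib_left mult_ac
            del: sum.atMost_Suc)
      thus ?thesis by blast
    qed
    have mem: "gen ?ps s \<in> fat \<mu>" if "s \<le> length ?ps" for s
    proof (cases s)
      case 0
      then show ?thesis using MM_fat[of _ 1] by (simp add: gen_Cons_0 fat_def)
    next
      case (Suc n)
      then show ?thesis using that ps(7) gen_up by (simp add: gen_Cons_Suc)
    qed
    show ?thesis
      by (rule exI[of _ ?ps], intro conjI)
        (use ps(1,4,5) i0 dec bd pos ms gens mem in auto)
  qed
qed

end

section \<open>Syzygies of a staircase\<close>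

text \<open>All terms but the last are divisible by \<open>B q = Y q * B (Suc q)\<close>, so
  \<open>Y q\<close> divides the last coefficient times \<open>A (Suc q)\<close>, and by coprimality
  the coefficient itself. Subtracting a multiple of the last basic syzygy leaves a relation on a
  shorter staircase.\<close>

lemma staircase_syzygy_exists:
  fixes A B X Y h :: "nat \<Rightarrow> 'a::idom"
  assumes "\<And>p. p < q \<Longrightarrow> A (Suc p) = A p * X p" "\<And>p. p < q \<Longrightarrow> B p = Y p * B (Suc p)"
    and "A 0 \<noteq> 0" "B q \<noteq> 0" "\<And>p. p < q \<Longrightarrow> Y p \<noteq> 0"
    and "\<And>p h. p < q \<Longrightarrow> Y p dvd h * A (Suc p) \<Longrightarrow> Y p dvd h"
    and "(\<Sum>p\<le>q. h p * (A p * B p)) = 0"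
  shows "\<exists>s. \<forall>p\<le>q. h p = (if p < q then s p * X p else 0) - (if 0 < p then s (p - 1) * Y (p - 1) else 0)"
  using assms
proof (induction q arbitrary: h)
  case 0
  then show ?case by simp
next
  case (Suc q)
  have B: "B p dvd B p'" if "p' \<le> p" "p \<le> q" for p p'
    using that(1,2)
  proof (induction p rule: dec_induct)
    case (step p)
    then show ?case using Suc.prems(2)[of p] by (metis Suc_leD dvd_triv_right dvd_trans le_imp_less_Suc)
  qed simp
  have Bq: "B q = Y q * B (Suc q)" using Suc.prems(2) by simp
  have "B q dvd (\<Sum>p\<le>q. h p * (A p * B p))"
    by (rule dvd_sum) (use B in \<open>auto intro!: dvd_mult\<close>)
  then obtain K where K: "(\<Sum>p\<le>q. h p * (A p * B p)) = B q * K" by blast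
  have "B (Suc q) * (h (Suc q) * A (Suc q)) = B (Suc q) * (Y q * - K)"
    using Suc.prems(7) K by (simp add: Bq algebra_simps eq_neg_iff_add_eq_0)
  hence "h (Suc q) * A (Suc q) = Y q * - K" using Suc.prems(4) by (metis mult_left_cancel)
  hence "Y q dvd h (Suc q)" using Suc.prems(6)[of q] by (metis dvd_triv_left lessI)
  then obtain s0 where s0: "h (Suc q) = Y q * s0" by blast
  \<comment> \<open>The last basic syzygy has \<open>- Y q\<close> in position \<open>Suc q\<close>,
    hence the sign.\<close>
  define s where "s = - s0"
  have hs: "h (Suc q) = - (s * Y q)" using s0 by (simp add: s_def)
  define h' where "h' = h(q := h q - s * X q)"
  have "(\<Sum>p\<le>q. h' p * (A p * B p)) = (\<Sum>p\<le>q. h p * (A p * B p) - (if p = q then s * X q * (A q * B q) else 0))"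
    by (rule sum.cong) (auto simp: h'_def algebra_simps)
  also have "\<dots> = (\<Sum>p\<le>q. h p * (A p * B p)) - s * X q * (A q * B q)"
    by (simp add: sum_subtractf)
  also have "s * X q * (A q * B q) = - (h (Suc q) * (A (Suc q) * B (Suc q)))"
    using Suc.prems(1)[of q] by (simp add: hs Bq mult_ac)
  also have "(\<Sum>p\<le>q. h p * (A p * B p)) - - (h (Suc q) * (A (Suc q) * B (Suc q))) = 0"
    using Suc.prems(7) by simp
  finally have h'0: "(\<Sum>p\<le>q. h' p * (A p * B p)) = 0" .
  have Bq0: "B q \<noteq> 0" using Bq Suc.prems(4,5) by simp
  have "\<exists>s. \<forall>p\<le>q. h' p = (if p < q then s p * X p else 0) - (if 0 < p then s (p - 1) * Y (p - 1) else 0)"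
  proof (rule Suc.IH)
    show "A (Suc p) = A p * X p" "B p = Y p * B (Suc p)" "Y p \<noteq> 0" if "p < q" for p
      using that Suc.prems(1,2,5)[of p] by auto
    show "Y p dvd h" if "p < q" "Y p dvd h * A (Suc p)" for p h
      using Suc.prems(6)[OF _ that(2)] that(1) by simp
  qed (use Suc.prems(3) Bq0 h'0 in auto)
  then obtain s' where s': "\<forall>p\<le>q. h' p = (if p < q then s' p * X p else 0) - (if 0 < p then s' (p - 1) * Y (p - 1) else 0)"
    by blast
  have "h p = (if p < Suc q then (s'(q := s)) p * X p else 0) - (if 0 < p then (s'(q := s)) (p - 1) * Y (p - 1) else 0)"
    if pq: "p \<le> Suc q" for p
  proof -
    consider "p < q" | "p = q" | "p = Suc q" using pq by linarith
    then show ?thesis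
    proof cases
      case 1 then show ?thesis using s'[rule_format, of p] by (auto simp: h'_def)
    next
      case 2
      have "h q = h' q + s * X q" by (simp add: h'_def)
      then show ?thesis using s'[rule_format, of q] 2 by (auto simp: algebra_simps)
    next
      case 3 then show ?thesis using hs by simp
    qed
  qed
  then show ?case by blast
qed

text \<open>The two contributions of \<open>s p\<close> cancel, because
  \<open>X p * A p * B p\<close> and \<open>Y p * A (Suc p) * B (Suc p)\<close> are the same
  product.\<close>

lemma staircase_syzygy_sum:
  fixes A B X Y s :: "nat \<Rightarrow> 'a::comm_ring_1"
  assumes "\<And>p. p < q \<Longrightarrow> A (Suc p) = A p * X p" "\<And>p. p < q \<Longrightarrow> B p = Y p * B (Suc p)"
  shows "(\<Sum>p\<le>q. ((if p < q then s p * X p else 0) - (if 0 < p then s (p - 1) * Y (p - 1) else 0))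
    * (A p * B p)) = 0"
proof -
  have "(\<Sum>p\<le>q. (if p < q then s p * X p else 0) * (A p * B p)) = (\<Sum>p<q. s p * (X p * A p * B p))"
    by (rule sum.mono_neutral_cong_right) (auto simp: mult_ac)
  moreover have "(\<Sum>p\<le>q. (if 0 < p then s (p - 1) * Y (p - 1) else 0) * (A p * B p))
      = (\<Sum>p<q. s p * (Y p * A (Suc p) * B (Suc p)))"
    by (cases q) (simp_all add: sum.atMost_Suc_shift lessThan_Suc_atMost mult_ac del: sum.atMost_Suc)
  moreover have "X p * A p * B p = Y p * A (Suc p) * B (Suc p)" if "p < q" for p
    using assms(1)[OF that] assms(2)[OF that] by (simp add: mult_ac)
  ultimately show ?thesis by (simp add: left_diff_distrib sum_subtractf)
qed

text \<open>The syzygy matrix is bidiagonal with nonzero diagonal \<open>X p\<close>, so the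
  coefficients vanish successively from \<open>p = 0\<close> on.\<close>

lemma staircase_syzygy_injective:
  fixes X Y s :: "nat \<Rightarrow> 'a::idom"
  assumes "\<And>p. p < q \<Longrightarrow> X p \<noteq> 0"
    and "\<And>p. p \<le> q \<Longrightarrow> (if p < q then s p * X p else 0) - (if 0 < p then s (p - 1) * Y (p - 1) else 0) = 0"
    and "p < q"
  shows "s p = 0"
  using assms(3)
proof (induction p)
  case 0 then show ?case using assms(1)[of 0] assms(2)[of 0] by simp
next
  case (Suc p) then show ?case using assms(1)[of "Suc p"] assms(2)[of "Suc p"] by simp
qed

section \<open>Substitutions and linear forms\<close>

text \<open>The order is arbitrary. It induces a linear order on exponents, through which
  polynomials over a domain become an instance of \<open>idom\<close>.\<close>

instantiation var :: linorder
begin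

definition var_index :: "var \<Rightarrow> nat" where
  "var_index v = (case v of X0 \<Rightarrow> 0 | X1 \<Rightarrow> 1 | Y0 \<Rightarrow> 2 | Y1 \<Rightarrow> 3)"

definition less_eq_var :: "var \<Rightarrow> var \<Rightarrow> bool" where
  "less_eq_var u v \<longleftrightarrow> var_index u \<le> var_index v"

definition less_var :: "var \<Rightarrow> var \<Rightarrow> bool" where
  "less_var u v \<longleftrightarrow> var_index u < var_index v"

instance
  by standard (auto simp: less_eq_var_def less_var_def var_index_def split: var.splits)

end

lemma prod_UNIV_var: "(\<Prod>v\<in>UNIV. f v) = f X0 * f X1 * f Y0 * f (Y1 :: var)"
proof -
  have "(\<Prod>v\<in>UNIV. f v) = (\<Prod>v\<in>{X0, X1, Y0, Y1}. f v)"
    by (rule prod.cong) (use var.exhaust in auto)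
  thus ?thesis by (simp add: mult_ac)
qed

lemma Const_add: "Const (a + b) = Const a + Const b"
  and Const_diff: "Const (a - b) = Const a - Const b"
  and Const_mult: "Const (a * b) = Const a * Const b"
  and Const_0: "Const 0 = 0" and Const_1: "Const 1 = 1"
  by (simp_all add: Const_def single_add single_diff mult_single)

lemma Const_eq_0_iff: "Const a = 0 \<longleftrightarrow> a = 0"
  unfolding Const_def by (metis lookup_single_eq lookup_zero single_zero)

lemma Var_nonzero: "Var v \<noteq> (0 :: 'k::comm_ring_1 bpoly)"
  unfolding Var_def by (metis lookup_single_eq lookup_zero zero_neq_one)

lemma Var_power: "Var v ^ n = Poly_Mapping.single (Poly_Mapping.single v n) (1 :: 'k::comm_ring_1)"
  by (induction n) (auto simp: Var_def mult_single simp flip: single_add)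

lemma single_eq_Const_mult_Vars:
  "Poly_Mapping.single e c = Const c * (\<Prod>v\<in>UNIV. Var v ^ Poly_Mapping.lookup e v)"
proof -
  let ?s = "\<lambda>v. Poly_Mapping.single v (Poly_Mapping.lookup e v)"
  have "e = ?s X0 + ?s X1 + ?s Y0 + ?s Y1"
  proof (rule poly_mapping_eqI)
    fix v
    show "Poly_Mapping.lookup e v = Poly_Mapping.lookup (?s X0 + ?s X1 + ?s Y0 + ?s Y1) v"
      by (cases v) (simp_all add: lookup_add lookup_single)
  qed
  then show ?thesis
    by (simp add: prod_UNIV_var Var_power Const_def mult_single)
qed

lemma bpoly_expansion:
  "p = (\<Sum>e\<in>Poly_Mapping.keys p. Poly_Mapping.single e (Poly_Mapping.lookup p e))"
  by (rule poly_mapping_eqI) (auto simp: lookup_sum lookup_single when_def in_keys_iff)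

lemma bpoly_induct [case_names Const Var add mult]:
  fixes p :: "'k::comm_ring_1 bpoly"
  assumes C: "\<And>c. P (Const c)" and V: "\<And>v. P (Var v)"
    and A: "\<And>a b. P a \<Longrightarrow> P b \<Longrightarrow> P (a + b)" and M: "\<And>a b. P a \<Longrightarrow> P b \<Longrightarrow> P (a * b)"
  shows "P p"
proof -
  have 0: "P 0" and 1: "P 1" using C[of 0] C[of 1] by (simp_all add: Const_0 Const_1)
  have pow: "P (Var v ^ n)" for v n by (induction n) (auto intro: 1 V M)
  have "P (Poly_Mapping.single e c)" for e c
    unfolding single_eq_Const_mult_Vars prod_UNIV_var by (intro M C pow)
  hence "P (\<Sum>e\<in>S. Poly_Mapping.single e (Poly_Mapping.lookup p e))" for S
    by (induction S rule: infinite_finite_induct) (auto intro: 0 A)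
  thus ?thesis by (metis bpoly_expansion)
qed

section \<open>Substitution endomorphisms and the primes given by linear forms\<close>

definition subst :: "(var \<Rightarrow> 'k::comm_ring_1 bpoly) \<Rightarrow> 'k bpoly \<Rightarrow> 'k bpoly" where
  "subst \<theta> p = (\<Sum>e\<in>Poly_Mapping.keys p.
     Const (Poly_Mapping.lookup p e) * (\<Prod>v\<in>UNIV. \<theta> v ^ Poly_Mapping.lookup e v))"

lemma subst_superset:
  assumes "finite S" "Poly_Mapping.keys p \<subseteq> S"
  shows "subst \<theta> p = (\<Sum>e\<in>S. Const (Poly_Mapping.lookup p e) * (\<Prod>v\<in>UNIV. \<theta> v ^ Poly_Mapping.lookup e v))"
  unfolding subst_def using assms
  by (intro sum.mono_neutral_left) (auto simp: in_keys_iff Const_0)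

lemma subst_add: "subst \<theta> (p + q) = subst \<theta> p + subst \<theta> q"
proof -
  let ?S = "Poly_Mapping.keys p \<union> Poly_Mapping.keys q"
  have "Poly_Mapping.keys (p + q) \<subseteq> ?S" by (rule keys_add)
  thus ?thesis
    by (simp add: subst_superset[of ?S] lookup_add Const_add distrib_right sum.distrib)
qed

lemma subst_0: "subst \<theta> 0 = 0"
  by (simp add: subst_def)

lemma subst_sum: "subst \<theta> (sum f S) = (\<Sum>x\<in>S. subst \<theta> (f x))"
  by (induction S rule: infinite_finite_induct) (auto simp: subst_0 subst_add)

lemma subst_single:
  "subst \<theta> (Poly_Mapping.single e c) = Const c * (\<Prod>v\<in>UNIV. \<theta> v ^ Poly_Mapping.lookup e v)"
  by (subst subst_superset[of "{e}"]) auto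

lemma subst_mult: "subst \<theta> (p * q) = subst \<theta> p * subst \<theta> q"
proof -
  let ?s = "\<lambda>p e. Poly_Mapping.single e (Poly_Mapping.lookup p e)"
  have "subst \<theta> (?s p e * ?s q e') = subst \<theta> (?s p e) * subst \<theta> (?s q e')" for e e'
    by (simp add: mult_single subst_single lookup_add power_add prod.distrib Const_mult mult_ac)
  hence "subst \<theta> ((\<Sum>e\<in>S. ?s p e) * (\<Sum>e\<in>T. ?s q e))
      = subst \<theta> (\<Sum>e\<in>S. ?s p e) * subst \<theta> (\<Sum>e\<in>T. ?s q e)" for S T
    by (simp add: sum_product subst_sum)
  from this[of "Poly_Mapping.keys p" "Poly_Mapping.keys q"] show ?thesis
    by (simp only: bpoly_expansion[symmetric])
qed

lemma subst_Const: "subst \<theta> (Const c) = Const c"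
  unfolding Const_def by (subst subst_single) (simp add: Const_def)

lemma subst_1: "subst \<theta> 1 = 1"
  using subst_Const[of \<theta> 1] by (simp add: Const_1)

lemma subst_Var: "subst \<theta> (Var v) = \<theta> v"
  unfolding Var_def by (subst subst_single) (cases v; simp add: prod_UNIV_var lookup_single Const_1)

lemma subst_diff: "subst \<theta> (p - q) = subst \<theta> p - subst \<theta> q"
  using subst_add[of \<theta> "p - q" q] by simp

lemma subst_power: "subst \<theta> (p ^ n) = subst \<theta> p ^ n"
  by (induction n) (auto simp: subst_1 subst_mult)

text \<open>The polynomials congruent to their image modulo \<open>l\<close> are closed under sums
  and products, so the variables decide.\<close>

lemma dvd_diff_subst:
  assumes "\<And>v. l dvd Var v - \<theta> v"
  shows "l dvd p - subst \<theta> p"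
proof (induction p rule: bpoly_induct)
  case (Const c) show ?case by (simp add: subst_Const)
next
  case (Var v) show ?case using assms by (simp add: subst_Var)
next
  case (add a b)
  from dvd_add[OF this] show ?case by (simp add: subst_add algebra_simps)
next
  case (mult a b)
  have "a * b - subst \<theta> (a * b) = (a - subst \<theta> a) * b + subst \<theta> a * (b - subst \<theta> b)"
    by (simp add: subst_mult algebra_simps)
  thus ?case using mult by simp
qed

definition lin :: "var \<Rightarrow> var \<Rightarrow> 'k::comm_ring_1 \<times> 'k \<Rightarrow> 'k bpoly" where
  "lin u v a = Const (snd a) * Var u - Const (fst a) * Var v"

text \<open>The substitution eliminating one variable by means of \<open>lin u v a = 0\<close>; it is a retraction
  onto a polynomial subring whose kernel is generated by \<open>lin u v a\<close>.\<close>
definition elim :: "var \<Rightarrow> var \<Rightarrow> 'k::field \<times> 'k \<Rightarrow> var \<Rightarrow> 'k bpoly" where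
  "elim u v a = (if fst a \<noteq> 0 then Var (v := Const (snd a / fst a) * Var u) else Var (u := 0))"

lemma subst_elim_Var: "x \<noteq> u \<Longrightarrow> x \<noteq> v \<Longrightarrow> subst (elim u v a) (Var x) = Var x"
  by (simp add: subst_Var elim_def)

lemma subst_elim_lin_other:
  "{x, y} \<inter> {u, v} = {} \<Longrightarrow> subst (elim u v a) (lin x y b) = lin x y b"
  by (auto simp: lin_def subst_diff subst_mult subst_Const subst_elim_Var)

text \<open>Only the kept variable survives, and its coefficient is, up to a nonzero scalar, the
  determinant of \<open>a\<close> and \<open>b\<close>.\<close>

lemma subst_elim_lin_same:
  assumes "u \<noteq> v" "a \<noteq> (0, 0)"
  obtains c z where "subst (elim u v a) (lin u v b) = Const c * Var z" "z \<in> {u, v}"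
    "c = 0 \<longleftrightarrow> fst a * snd b = snd a * fst b"
proof (cases "fst a = 0")
  case True
  hence "subst (elim u v a) (lin u v b) = Const (- fst b) * Var v"
    using assms(1) Const_diff[of 0 "fst b"]
    by (simp add: lin_def subst_diff subst_mult subst_Const subst_Var elim_def Const_0)
  moreover have "- fst b = 0 \<longleftrightarrow> fst a * snd b = snd a * fst b"
    using True assms(2) by (cases a) auto
  ultimately show ?thesis using that by blast
next
  case False
  have "subst (elim u v a) (lin u v b) = Const (snd b - fst b * (snd a / fst a)) * Var u"
    using assms(1) False
    by (simp add: lin_def subst_diff subst_mult subst_Const subst_Var elim_def Const_diff Const_mult
        left_diff_distrib mult.assoc del: times_divide_eq_right)
  moreover have "snd b - fst b * (snd a / fst a) = 0 \<longleftrightarrow> fst a * snd b = snd a * fst b"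
    using False by (simp add: field_simps)
  ultimately show ?thesis using that by blast
qed

lemma Const_unit_dvd: "c \<noteq> 0 \<Longrightarrow> Const c * p dvd q \<longleftrightarrow> p dvd (q :: 'k::field bpoly)"
proof -
  assume c: "c \<noteq> 0"
  have "p dvd q \<Longrightarrow> Const c * p dvd Const (inverse c) * (Const c * q)"
    by (intro dvd_mult mult_dvd_mono) auto
  moreover have "Const (inverse c) * (Const c * q) = q"
    using c by (simp add: mult.assoc[symmetric] Const_mult[symmetric] Const_1)
  ultimately show ?thesis using dvd_mult_right by auto
qed

lemma lin_dvd_diff_subst_elim:
  fixes a :: "'k::field \<times> 'k"
  assumes "a \<noteq> (0, 0)"
  shows "lin u v a dvd p - subst (elim u v a) p"
proof (rule dvd_diff_subst)
  fix x
  show "lin u v a dvd Var x - elim u v a x"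
  proof (cases "fst a = 0")
    case True
    hence "snd a \<noteq> 0" using assms by (cases a) auto
    hence "lin u v a dvd Var u" using True by (simp add: lin_def Const_0 Const_unit_dvd)
    thus ?thesis using True by (auto simp: elim_def)
  next
    case False
    have "lin u v a = Const (- fst a) * (Var v - Const (snd a / fst a) * Var u)"
      using False Const_diff[of 0 "fst a"]
      by (simp add: lin_def algebra_simps Const_0 mult.assoc[symmetric] Const_mult[symmetric])
    hence "lin u v a dvd Var v - Const (snd a / fst a) * Var u"
      using False Const_unit_dvd[of "- fst a" "Var v - Const (snd a / fst a) * Var u"] by simp
    thus ?thesis using False by (auto simp: elim_def)
  qed
qed

text \<open>The elimination kills the form and changes any polynomial only by a multiple of
  it.\<close>

lemma lin_dvd_iff:
  assumes "u \<noteq> v" "a \<noteq> (0, 0)"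
  shows "lin u v a dvd p \<longleftrightarrow> subst (elim u v a) p = 0"
proof
  obtain c z where "subst (elim u v a) (lin u v a) = Const c * Var z"
    "c = 0 \<longleftrightarrow> fst a * snd a = snd a * fst a" using subst_elim_lin_same[OF assms] by blast
  hence "subst (elim u v a) (lin u v a) = 0" by (simp add: mult.commute Const_0)
  thus "subst (elim u v a) p = 0" if "lin u v a dvd p"
    using that by (auto simp: subst_mult)
  show "lin u v a dvd p" if "subst (elim u v a) p = 0"
    using lin_dvd_diff_subst_elim[OF assms(2), of u v p] that by simp
qed

lemma lin_nonzero:
  assumes "u \<noteq> v" "a \<noteq> (0, 0)"
  shows "lin u v a \<noteq> (0 :: 'k::field bpoly)"
proof
  assume 0: "lin u v a = 0"
  let ?e = "\<lambda>x. Poly_Mapping.single x (1::nat)"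
  have ne: "?e u \<noteq> ?e v" using assms(1) by (metis lookup_single_eq lookup_single_not_eq zero_neq_one)
  have eq: "lin u v a = Poly_Mapping.single (?e u) (snd a) - Poly_Mapping.single (?e v) (fst a)"
    by (simp add: lin_def Const_def Var_def mult_single)
  have "Poly_Mapping.lookup (lin u v a) (?e u) = snd a" "Poly_Mapping.lookup (lin u v a) (?e v) = - fst a"
    unfolding eq using ne by (simp_all add: lookup_minus lookup_single when_def)
  thus False using 0 assms(2) by (cases a) auto
qed

text \<open>The form generates the kernel of a homomorphism into a domain.\<close>

lemma prime_lin:
  assumes "u \<noteq> v" "a \<noteq> (0, 0)"
  shows "prime_elem (lin u v a :: 'k::field bpoly)"
  by (rule prime_elemI) (auto simp: lin_nonzero[OF assms] lin_dvd_iff[OF assms] subst_1 subst_mult)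

section \<open>Bihomogeneous components\<close>

lemma bideg_add: "bideg (e + e') = (fst (bideg e) + fst (bideg e'), snd (bideg e) + snd (bideg e'))"
  by (simp add: bideg_def lookup_add)

lemma bihomog_0: "bihomog 0 d"
  by (simp add: bihomog_def)

lemma bihomog_diff: "bihomog p d \<Longrightarrow> bihomog q d \<Longrightarrow> bihomog (p - q) d"
  using keys_diff[of p q] unfolding bihomog_def by blast

lemma bihomog_mult:
  "bihomog p (a, b) \<Longrightarrow> bihomog q (a', b') \<Longrightarrow> bihomog (p * q) (a + a', b + b')"
  using keys_mult[of p q] unfolding bihomog_def by (fastforce simp: bideg_add)

lemma bihomog_Const: "bihomog (Const c) (0, 0)"
  by (auto simp: bihomog_def Const_def bideg_def)

lemma bihomog_1: "bihomog (1 :: 'k::comm_ring_1 bpoly) (0, 0)"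
  using bihomog_Const[of 1] by (simp add: Const_1)

lemma bihomog_minus: "bihomog p d \<Longrightarrow> bihomog (- p :: 'k::comm_ring_1 bpoly) d"
  using bihomog_diff[OF bihomog_0, of p d] by simp

lemma bihomog_power:
  "bihomog p (a, b) \<Longrightarrow> bihomog (p ^ n :: 'k::comm_ring_1 bpoly) (int n * a, int n * b)"
proof (induction n)
  case (Suc n)
  from bihomog_mult[OF Suc.prems Suc.IH[OF Suc.prems]] show ?case by (simp add: algebra_simps)
qed (simp add: bihomog_1)

lemma bihomog_prod:
  assumes "\<And>x. x \<in> S \<Longrightarrow> bihomog (f x :: 'k::comm_ring_1 bpoly) (a x, b x)"
  shows "bihomog (\<Prod>x\<in>S. f x) (\<Sum>x\<in>S. a x, \<Sum>x\<in>S. b x)"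
  using assms by (induction S rule: infinite_finite_induct) (auto simp: bihomog_1 intro!: bihomog_mult)

lemma bihomog_Var: "bihomog (Var v) (bideg (Poly_Mapping.single v 1))"
  by (auto simp: bihomog_def Var_def)

lemma bihomog_lin_X: "bihomog (lin X0 X1 a) (1, 0)"
  unfolding lin_def
  using bihomog_mult[OF bihomog_Const[of "snd a"], of "Var X0" 1 0] bihomog_Var[of X0]
    bihomog_mult[OF bihomog_Const[of "fst a"], of "Var X1" 1 0] bihomog_Var[of X1]
  by (intro bihomog_diff) (auto simp: bideg_def lookup_single)

lemma bihomog_lin_Y: "bihomog (lin Y0 Y1 a) (0, 1)"
  unfolding lin_def
  using bihomog_mult[OF bihomog_Const[of "snd a"], of "Var Y0" 0 1] bihomog_Var[of Y0]
    bihomog_mult[OF bihomog_Const[of "fst a"], of "Var Y1" 0 1] bihomog_Var[of Y1]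
  by (intro bihomog_diff) (auto simp: bideg_def lookup_single)

definition bicomp :: "int \<times> int \<Rightarrow> 'k::comm_ring_1 bpoly \<Rightarrow> 'k bpoly" where
  "bicomp d p = (\<Sum>e\<in>{e \<in> Poly_Mapping.keys p. bideg e = d}. Poly_Mapping.single e (Poly_Mapping.lookup p e))"

lemma lookup_bicomp: "Poly_Mapping.lookup (bicomp d p) e = (if bideg e = d then Poly_Mapping.lookup p e else 0)"
  by (auto simp: bicomp_def lookup_sum lookup_single when_def in_keys_iff)

lemma bicomp_add: "bicomp d (p + q) = bicomp d p + bicomp d q"
  by (rule poly_mapping_eqI) (simp add: lookup_bicomp lookup_add)

lemma bicomp_0: "bicomp d 0 = 0"
  by (rule poly_mapping_eqI) (simp add: lookup_bicomp)

lemma bicomp_diff: "bicomp d (p - q) = bicomp d p - bicomp d q"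
  using bicomp_add[of d "p - q" q] by simp

lemma bicomp_sum: "bicomp d (sum f S) = (\<Sum>x\<in>S. bicomp d (f x))"
  by (induction S rule: infinite_finite_induct) (auto simp: bicomp_0 bicomp_add)

lemma bicomp_single: "bicomp d (Poly_Mapping.single e c) = (if bideg e = d then Poly_Mapping.single e c else 0)"
  by (rule poly_mapping_eqI) (auto simp: lookup_bicomp lookup_single when_def)

lemma bihomog_bicomp: "bihomog (bicomp d p) d"
  by (auto simp: bihomog_def in_keys_iff lookup_bicomp split: if_splits)

lemma bicomp_of_bihomog: "bihomog p d \<Longrightarrow> bicomp d p = p"
  by (rule poly_mapping_eqI) (auto simp: bihomog_def in_keys_iff lookup_bicomp)

lemma bicomp_negative: "d1 < 0 \<or> d2 < 0 \<Longrightarrow> bicomp (d1, d2) p = 0"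
  by (rule poly_mapping_eqI) (auto simp: lookup_bicomp bideg_def)

lemma bicomp_mult_bihomog:
  assumes "bihomog h (e1, e2)"
  shows "bicomp (d1, d2) (a * h) = bicomp (d1 - e1, d2 - e2) a * h"
proof -
  let ?s = "\<lambda>p e. Poly_Mapping.single e (Poly_Mapping.lookup p e)"
  have "bicomp (d1, d2) (?s a e * ?s h e') = bicomp (d1 - e1, d2 - e2) (?s a e) * ?s h e'"
    if "e' \<in> Poly_Mapping.keys h" for e e'
  proof -
    have "bideg e' = (e1, e2)" using assms that by (simp add: bihomog_def)
    hence "bideg (e + e') = (d1, d2) \<longleftrightarrow> bideg e = (d1 - e1, d2 - e2)"
      by (cases "bideg e") (auto simp: bideg_add)
    thus ?thesis by (simp add: mult_single bicomp_single)
  qed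
  hence "bicomp (d1, d2) ((\<Sum>e\<in>Poly_Mapping.keys a. ?s a e) * (\<Sum>e\<in>Poly_Mapping.keys h. ?s h e))
      = bicomp (d1 - e1, d2 - e2) (\<Sum>e\<in>Poly_Mapping.keys a. ?s a e) * (\<Sum>e\<in>Poly_Mapping.keys h. ?s h e)"
    by (simp add: sum_product bicomp_sum)
  thus ?thesis by (simp only: bpoly_expansion[symmetric])
qed

section \<open>Regular sequences\<close>

lemma is_ideal_radical:
  assumes "is_ideal (J :: 'a::comm_ring_1 set)"
  shows "is_ideal {f. \<exists>n. f ^ n \<in> J}"
proof -
  \<comment> \<open>The factor \<open>c\<close> collects the copies of \<open>a\<close> and
    \<open>b\<close> already split off; this allows an induction on \<open>n + k\<close> instead of
    a binomial expansion.\<close>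
  have sum: "c * (a + b) ^ (n + k) \<in> J" if "c * a ^ n \<in> J" "c * b ^ k \<in> J" for a b c n k
    using that
  proof (induction "n + k" arbitrary: n k c rule: less_induct)
    case less
    show ?case
    proof (cases "n = 0 \<or> k = 0")
      case True
      hence "c \<in> J" using less.prems by auto
      thus ?thesis using ideal_mult_left[OF assms] by (metis mult.commute)
    next
      case False
      then obtain n' k' where nk: "n = Suc n'" "k = Suc k'" by (metis not0_implies_Suc)
      have "(c * a) * (a + b) ^ (n' + k) \<in> J"
        using less.prems nk ideal_mult_left[OF assms less.prems(2), of a]
        by (intro less.hyps) (auto simp: mult_ac)
      moreover have "(c * b) * (a + b) ^ (n + k') \<in> J"
        using less.prems nk ideal_mult_left[OF assms less.prems(1), of b]
        by (intro less.hyps) (auto simp: mult_ac)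
      ultimately have "(c * a) * (a + b) ^ (n' + k) + (c * b) * (a + b) ^ (n + k') \<in> J"
        by (rule ideal_add[OF assms])
      thus ?thesis by (simp add: nk algebra_simps)
    qed
  qed
  show ?thesis unfolding is_ideal_def
  proof (intro conjI ballI allI; clarsimp)
    show "\<exists>n. 0 ^ n \<in> J" using ideal_zero[OF assms] by (intro exI[of _ 1]) simp
    show "\<exists>n. (a + b) ^ n \<in> J" if "a ^ n \<in> J" "b ^ k \<in> J" for a b n k
      using sum[of 1 a n b k] that by auto
    show "\<exists>n. (r * a) ^ n \<in> J" if "a ^ n \<in> J" for a r n
      using ideal_mult_left[OF assms that] by (auto simp: power_mult_distrib)
  qed
qed

lemma nonzerodivisor_power:
  fixes f :: "'a::comm_ring_1"
  assumes "\<And>g. f * g \<in> J \<Longrightarrow> g \<in> J" "f ^ n * g \<in> J"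
  shows "g \<in> J"
  using assms(2) by (induction n arbitrary: g) (auto simp: mult.assoc dest: assms(1))

text \<open>First \<open>f2 ^ k\<close> is a nonzerodivisor modulo \<open>J\<close> and
  \<open>f1\<close>. Then \<open>g\<close> is a multiple \<open>b * f1\<close> modulo
  \<open>J\<close>, one \<open>f1\<close> cancels, and the induction on \<open>n\<close> applies to
  \<open>b\<close>.\<close>

lemma regular_pair_powers:
  fixes f1 f2 :: "'a::comm_ring_1"
  assumes J: "is_ideal J" and r1: "\<And>g. f1 * g \<in> J \<Longrightarrow> g \<in> J"
    and r2: "\<And>g a. f2 * g - a * f1 \<in> J \<Longrightarrow> \<exists>b. g - b * f1 \<in> J"
    and "f2 ^ k * g - a * f1 ^ n \<in> J"
  shows "\<exists>b. g - b * f1 ^ n \<in> J"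
proof -
  have r2k: "\<exists>b. g - b * f1 \<in> J" if "f2 ^ k * g - a * f1 \<in> J" for g a
    using that
  proof (induction k arbitrary: g a)
    case (Suc k)
    hence "f2 ^ k * (f2 * g) - a * f1 \<in> J" by (simp add: mult_ac)
    then obtain b where "f2 * g - b * f1 \<in> J" using Suc.IH by blast
    then show ?case by (rule r2)
  qed auto
  show ?thesis using assms(4)
  proof (induction n arbitrary: g a)
    case 0
    show ?case using ideal_zero[OF J] by (intro exI[of _ g]) simp
  next
    case (Suc n)
    have "f2 ^ k * g - (a * f1 ^ n) * f1 \<in> J" using Suc.prems by (simp add: mult_ac)
    then obtain b where b: "g - b * f1 \<in> J" using r2k by blast
    have "(f2 ^ k * g - a * f1 ^ Suc n) - f2 ^ k * (g - b * f1) \<in> J"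
      by (intro ideal_diff ideal_mult_left J Suc.prems b)
    hence "f1 * (f2 ^ k * b - a * f1 ^ n) \<in> J" by (simp add: algebra_simps)
    hence "f2 ^ k * b - a * f1 ^ n \<in> J" by (rule r1)
    then obtain b' where b': "b - b' * f1 ^ n \<in> J" using Suc.IH by blast
    have "(g - b * f1) + f1 * (b - b' * f1 ^ n) \<in> J" by (intro ideal_add ideal_mult_left J b b')
    thus ?case by (intro exI[of _ b']) (simp add: algebra_simps)
  qed
qed

lemma regular_pair_of_depth:
  fixes J :: "'k::comm_ring_1 bpoly set"
  assumes J: "is_ideal J" and "2 \<le> depth_quot J"
  obtains f1 f2 where "f1 \<in> max_ideal" "f2 \<in> max_ideal" "\<And>g. f1 * g \<in> J \<Longrightarrow> g \<in> J"
    "\<And>g a. f2 * g - a * f1 \<in> J \<Longrightarrow> \<exists>b. g - b * f1 \<in> J"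
proof -
  have "\<exists>fs :: 'k bpoly list. set fs \<subseteq> max_ideal \<and> regular_seq J fs \<and> 2 \<le> length fs"
  proof (rule ccontr)
    assume "\<not> ?thesis"
    hence "depth_quot J \<le> 1" unfolding depth_quot_def
      by (intro Sup_least) (auto simp: one_enat_def not_le)
    with assms(2) show False by (metis numeral_le_one_iff order_trans semiring_norm(69))
  qed
  then obtain fs :: "'k bpoly list" where fs: "set fs \<subseteq> max_ideal" "regular_seq J fs" "2 \<le> length fs"
    by blast
  then obtain f1 f2 fs' where eq: "fs = f1 # f2 # fs'"
    by (cases fs; cases "tl fs") auto
  have reg: "fs ! i * g \<in> ideal_gen (J \<union> set (take i fs)) \<Longrightarrow> g \<in> ideal_gen (J \<union> set (take i fs))"
    if "i < length fs" for i g
    using fs(2) that unfolding regular_seq_def by blast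
  have r1: "f1 * g \<in> J \<Longrightarrow> g \<in> J" for g
    using reg[of 0 g] by (simp add: eq ideal_gen_ideal[OF J])
  have "f2 * g \<in> ideal_gen (J \<union> {f1}) \<Longrightarrow> g \<in> ideal_gen (J \<union> {f1})" for g
    using reg[of 1 g] by (simp add: eq)
  hence r2: "f2 * g - a * f1 \<in> J \<Longrightarrow> \<exists>b. g - b * f1 \<in> J" for g a
    using mem_ideal_gen_insert[OF J] by blast
  show ?thesis using that[of f1 f2] fs(1) r1 r2 by (simp add: eq)
qed

section \<open>Cohen-Macaulay fat points\<close>

text \<open>Cramer's rule; \<open>D\<close> is, up to sign, the determinant of the two
  points.\<close>

lemma Var_in_span_lin:
  fixes a b :: "'k::field \<times> 'k"
  assumes "fst a * snd b \<noteq> snd a * fst b" "x = u \<or> x = v"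
  shows "\<exists>s t. Var x = s * lin u v a + t * lin u v b"
proof -
  define D where "D = snd a * fst b - fst a * snd b"
  have D: "D \<noteq> 0" using assms(1) by (simp add: D_def)
  have inv: "Const (1 / D) * (Const D * p) = p" for p
    using D by (simp add: mult.assoc[symmetric] Const_mult[symmetric] Const_1)
  have "Const D * Var u = Const (fst b) * lin u v a - Const (fst a) * lin u v b"
    by (simp add: D_def lin_def Const_diff Const_mult algebra_simps)
  from arg_cong[OF this, of "\<lambda>p. Const (1 / D) * p"]
  have u: "Var u = (Const (1 / D) * Const (fst b)) * lin u v a + (- (Const (1 / D) * Const (fst a))) * lin u v b"
    unfolding inv by (simp add: algebra_simps)
  have "Const D * Var v = Const (snd b) * lin u v a - Const (snd a) * lin u v b"
    by (simp add: D_def lin_def Const_diff Const_mult algebra_simps)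
  from arg_cong[OF this, of "\<lambda>p. Const (1 / D) * p"]
  have v: "Var v = (Const (1 / D) * Const (snd b)) * lin u v a + (- (Const (1 / D) * Const (snd a))) * lin u v b"
    unfolding inv by (simp add: algebra_simps)
  from u v assms(2) show ?thesis by blast
qed

section \<open>The grid of a fat point scheme and its bigrading\<close>

locale fat_points =
  fixes r t :: nat and R Q :: "nat \<Rightarrow> 'k::field \<times> 'k" and m :: "nat \<Rightarrow> nat \<Rightarrow> nat"
  assumes valid: "valid_fat_data r t R Q m"
begin

lemma R_nonzero: "i < r \<Longrightarrow> R i \<noteq> (0, 0)" and Q_nonzero: "j < t \<Longrightarrow> Q j \<noteq> (0, 0)"
  and R_indep: "i < r \<Longrightarrow> i' < r \<Longrightarrow> i \<noteq> i' \<Longrightarrow> fst (R i) * snd (R i') \<noteq> snd (R i) * fst (R i')"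
  and Q_indep: "j < t \<Longrightarrow> j' < t \<Longrightarrow> j \<noteq> j' \<Longrightarrow> fst (Q j) * snd (Q j') \<noteq> snd (Q j) * fst (Q j')"
  using valid unfolding valid_fat_data_def by blast+

text \<open>Reduction modulo a form in \<open>X0\<close>, \<open>X1\<close> is realised by
  eliminating one of these variables, which leaves forms in \<open>Y0\<close>, \<open>Y1\<close>
  untouched.\<close>

sublocale grid r t "\<lambda>i. lin X0 X1 (R i)" "\<lambda>j. lin Y0 Y1 (Q j)" "\<lambda>i. subst (elim X0 X1 (R i))"
proof
  fix i i' j j' :: nat and p a b :: "'k bpoly"
  show "prime_elem (lin X0 X1 (R i))" if "i < r" using prime_lin[OF _ R_nonzero] that by simp
  show "prime_elem (lin Y0 Y1 (Q j))" if "j < t" using prime_lin[OF _ Q_nonzero] that by simp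
  show "\<not> lin X0 X1 (R i) dvd lin X0 X1 (R i')" if ii: "i < r" "i' < r" "i \<noteq> i'"
  proof -
    obtain c z where "subst (elim X0 X1 (R i)) (lin X0 X1 (R i')) = Const c * Var z" "c \<noteq> 0"
      by (rule subst_elim_lin_same[of X0 X1 "R i" "R i'"]) (use R_nonzero R_indep[of i i'] ii in auto)
    thus ?thesis using ii R_nonzero[of i] by (simp add: lin_dvd_iff Const_eq_0_iff Var_nonzero)
  qed
  show "\<not> lin Y0 Y1 (Q j) dvd lin Y0 Y1 (Q j')" if jj: "j < t" "j' < t" "j \<noteq> j'"
  proof -
    obtain c z where "subst (elim Y0 Y1 (Q j)) (lin Y0 Y1 (Q j')) = Const c * Var z" "c \<noteq> 0"
      by (rule subst_elim_lin_same[of Y0 Y1 "Q j" "Q j'"]) (use Q_nonzero Q_indep[of j j'] jj in auto)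
    thus ?thesis using jj Q_nonzero[of j] by (simp add: lin_dvd_iff Const_eq_0_iff Var_nonzero)
  qed
  show "\<not> lin Y0 Y1 (Q j) dvd lin X0 X1 (R i)" if "j < t" "i < r"
    using that R_nonzero[of i] Q_nonzero[of j] by (simp add: lin_dvd_iff subst_elim_lin_other lin_nonzero)
  show "subst (elim X0 X1 (R i)) (lin X0 X1 (R i)) = 0" if "i < r"
    using that R_nonzero lin_dvd_iff[of X0 X1 "R i" "lin X0 X1 (R i)"] by simp
  show "lin X0 X1 (R i) dvd p - subst (elim X0 X1 (R i)) p" if "i < r"
    using that R_nonzero by (intro lin_dvd_diff_subst_elim)
  show "\<not> lin Y0 Y1 (Q j) dvd subst (elim X0 X1 (R i)) (lin X0 X1 (R i'))"
    if ii: "i < r" "i' < r" "i \<noteq> i'" "j < t"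
  proof -
    obtain c z where "subst (elim X0 X1 (R i)) (lin X0 X1 (R i')) = Const c * Var z" "z \<in> {X0, X1}" "c \<noteq> 0"
      by (rule subst_elim_lin_same[of X0 X1 "R i" "R i'"]) (use R_nonzero R_indep[of i i'] ii in auto)
    thus ?thesis using ii Q_nonzero[of j]
      by (auto simp: lin_dvd_iff subst_mult subst_Const subst_elim_Var Const_eq_0_iff Var_nonzero)
  qed
qed (auto simp: subst_add subst_mult subst_1 subst_elim_lin_other)

abbreviation L :: "nat \<Rightarrow> 'k bpoly" where "L i \<equiv> lin X0 X1 (R i)"
abbreviation M :: "nat \<Rightarrow> 'k bpoly" where "M j \<equiv> lin Y0 Y1 (Q j)"

text \<open>A pair of multiplicity 0 imposes no condition in \<open>fat\<close> either, since
  \<open>pw\<close> with exponent 0 is the whole ring.\<close>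

lemma fat_ideal_eq_fat: "fat_ideal r t R Q m = fat m"
proof -
  have "pt_ideal (R i) (Q j) = ideal_gen {L i, M j}" for i j by (simp add: pt_ideal_def lin_def)
  hence "fat_ideal r t R Q m = \<Inter> {pw (L i) (M j) (m i j) | i j. i < r \<and> j < t \<and> 0 < m i j}"
    by (simp add: fat_ideal_def ideal_pow_pair_eq_pw)
  also have "\<dots> = fat m"
  proof (intro set_eqI iffI)
    fix p assume "p \<in> \<Inter> {pw (L i) (M j) (m i j) | i j. i < r \<and> j < t \<and> 0 < m i j}"
    hence "p \<in> pw (L i) (M j) (m i j)" if "i < r" "j < t" "0 < m i j" for i j using that by blast
    moreover have "p \<in> pw (L i) (M j) 0" for i j by simp
    ultimately show "p \<in> fat m" unfolding fat_def row_def
      by (auto, metis gr0I)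
  next
    fix p assume "p \<in> fat m"
    thus "p \<in> \<Inter> {pw (L i) (M j) (m i j) | i j. i < r \<and> j < t \<and> 0 < m i j}"
      unfolding fat_def row_def by blast
  qed
  finally show ?thesis .
qed

lemma bihomog_MM: "bihomog (MM w) (0, int (\<Sum>j<t. w j))"
  using bihomog_prod[of "{..<t}" "\<lambda>j. M j ^ w j" "\<lambda>_. 0" "\<lambda>j. int (w j)"]
    bihomog_power[OF bihomog_lin_Y, of "Q _"]
  by (simp add: MM_def)

lemma bihomog_prod_L: "bihomog (\<Prod>i\<in>S. L i ^ w i) (int (\<Sum>i\<in>S. w i), 0)"
  using bihomog_prod[of S "\<lambda>i. L i ^ w i" "\<lambda>i. int (w i)" "\<lambda>_. 0"]
    bihomog_power[OF bihomog_lin_X, of "R _"]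
  by simp

text \<open>The generators are bihomogeneous, so taking a component acts on the coefficients of the
  expansion. The x-degree varies in the induction because the cofactor of \<open>L i\<close> has
  x-degree one less.\<close>

lemma pw_bicomp: "p \<in> pw (L i) (M j) n \<Longrightarrow> bicomp (d1, d2) p \<in> pw (L i) (M j) n"
proof (induction n arbitrary: p d1)
  case (Suc n)
  then obtain c q where p: "p = c * M j ^ Suc n + q * L i" "q \<in> pw (L i) (M j) n"
    by (auto elim!: pw_SucE simp: mult.commute)
  have "bihomog (M j ^ Suc n) (0, int (Suc n))"
    using bihomog_power[OF bihomog_lin_Y, of "Q j" "Suc n"] by simp
  hence "bicomp (d1, d2) p = bicomp (d1 - 0, d2 - int (Suc n)) c * M j ^ Suc n + L i * bicomp (d1 - 1, d2 - 0) q"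
    unfolding p(1) bicomp_add by (simp only: bicomp_mult_bihomog bicomp_mult_bihomog[OF bihomog_lin_X] mult.commute[of "L i"])
  then show ?case using Suc.IH[OF p(2), of "d1 - 1"] by (intro pw_SucI) auto
qed simp

lemma row_bicomp: "p \<in> row i w \<Longrightarrow> bicomp (d1, d2) p \<in> row i w"
  using pw_bicomp by (auto simp: row_def)

text \<open>Expanding \<open>p\<close> in powers of \<open>L i\<close>, the coefficient of the
  \<open>s\<close>-th power is a multiple of \<open>\<Sum>j<t. w j - s\<close> forms in y. For
  \<open>s \<le> k\<close> this number exceeds the y-degree of \<open>p\<close>, so these terms
  vanish.\<close>

lemma row_low_degree_dvd:
  assumes "i < r" "p \<in> row i w" "bihomog p (d1, d2)" "d2 < int (\<Sum>j<t. w j - k)"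
  shows "L i ^ Suc k dvd p"
  using assms(2-4)
proof (induction k arbitrary: p w d1)
  case (0 p w d1)
  obtain c q where p: "p = c * MM w + q * L i" "q \<in> row i (\<lambda>j. w j - 1)"
    using row_decomp[OF assms(1) 0(1)] by (metis mult.commute)
  have "p = bicomp (d1, d2) p" using bicomp_of_bihomog[OF 0(2)] by simp
  also have "\<dots> = bicomp (d1 - 0, d2 - int (\<Sum>j<t. w j)) c * MM w + bicomp (d1 - 1, d2 - 0) q * L i"
    unfolding p(1) bicomp_add
    by (simp only: bicomp_mult_bihomog[OF bihomog_MM] bicomp_mult_bihomog[OF bihomog_lin_X])
  also have "bicomp (d1 - 0, d2 - int (\<Sum>j<t. w j)) c = 0" using 0(3) by (intro bicomp_negative) simp
  finally have "p = bicomp (d1 - 1, d2 - 0) q * L i" by simp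
  thus ?case by (metis dvd_triv_right power_Suc0_right)
next
  case (Suc k)
  obtain c q where p: "p = c * MM w + q * L i" "q \<in> row i (\<lambda>j. w j - 1)"
    using row_decomp[OF assms(1) Suc.prems(1)] by (metis mult.commute)
  have "(\<Sum>j<t. w j - Suc k) \<le> (\<Sum>j<t. w j)" by (intro sum_mono) simp
  hence lt: "d2 < int (\<Sum>j<t. w j)" using Suc.prems(3) by linarith
  have "p = bicomp (d1, d2) p" using bicomp_of_bihomog[OF Suc.prems(2)] by simp
  also have "\<dots> = bicomp (d1 - 0, d2 - int (\<Sum>j<t. w j)) c * MM w + bicomp (d1 - 1, d2 - 0) q * L i"
    unfolding p(1) bicomp_add
    by (simp only: bicomp_mult_bihomog[OF bihomog_MM] bicomp_mult_bihomog[OF bihomog_lin_X])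
  also have "bicomp (d1 - 0, d2 - int (\<Sum>j<t. w j)) c = 0" using lt by (intro bicomp_negative) simp
  finally have pq: "p = bicomp (d1 - 1, d2) q * L i" by simp
  have "L i ^ Suc k dvd bicomp (d1 - 1, d2) q"
  proof (rule Suc.IH[OF row_bicomp[OF p(2)] bihomog_bicomp])
    have "w j - 1 - k = w j - Suc k" for j by simp
    thus "d2 < int (\<Sum>j<t. w j - 1 - k)" using Suc.prems(3) by presburger
  qed
  thus ?case using pq by (metis mult_dvd_mono dvd_refl power_Suc2)
qed

end

section \<open>Nonzerodivisors on a row, and minimal incomparable rows\<close>

context grid
begin

lemma row_cancel_prod_L:
  assumes "finite S" "S \<subseteq> {..<r} - {i}" "i < r" "(\<Prod>l\<in>S. L l ^ n) * x \<in> row i w"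
  shows "x \<in> row i w"
  using assms
proof (induction S arbitrary: x rule: finite_induct)
  case (insert l S)
  have l: "l < r" "i \<noteq> l" using insert.prems(1) by auto
  have "x \<in> row i w" if "L l ^ n * x \<in> row i w" for n x
    using that
  proof (induction n)
    case (Suc n)
    hence "L l * (L l ^ n * x) \<in> row i w" by (simp add: mult.assoc)
    hence "L l ^ n * x \<in> row i w" by (rule row_cancel_other_L[OF insert.prems(2) l])
    then show ?case by (rule Suc.IH)
  qed simp
  moreover have "L l ^ n * x \<in> row i w"
  proof (rule insert.IH[OF _ insert.prems(2)])
    have "(\<Prod>l\<in>S. L l ^ n) * (L l ^ n * x) = (\<Prod>l\<in>insert l S. L l ^ n) * x"
      using insert.hyps by (simp add: mult_ac)
    thus "(\<Prod>l\<in>S. L l ^ n) * (L l ^ n * x) \<in> row i w" using insert.prems(3) by (rule ssubst)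
  qed (use insert.prems(1) in auto)
  ultimately show ?case by blast
qed simp

lemma MM_add: "MM (\<lambda>j. u j + v j) = MM u * MM v"
  by (simp add: MM_def power_add prod.distrib)

text \<open>High powers of the other lines move the product into all rows, where the hypothesis on
  \<open>fat \<mu>\<close> applies; on row \<open>i\<close> these powers cancel again.\<close>

lemma nonzerodivisor_row:
  assumes "\<And>g. f * g \<in> fat \<mu> \<Longrightarrow> g \<in> fat \<mu>" "i < r" "f ^ n * x \<in> row i (\<mu> i)"
  shows "x \<in> row i (\<mu> i)"
proof -
  \<comment> \<open>A crude bound for all multiplicities, so the \<open>b\<close>-th power of each
    line form lies in the row of that line.\<close>
  define b where "b = (\<Sum>l<r. \<Sum>j<t. \<mu> l j)"
  have b: "\<mu> l j \<le> b" if "l < r" "j < t" for l j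
  proof -
    have "\<mu> l j \<le> (\<Sum>j<t. \<mu> l j)" using that by (intro member_le_sum) auto
    also have "\<dots> \<le> b" unfolding b_def using that by (intro member_le_sum) auto
    finally show ?thesis .
  qed
  let ?H = "\<Prod>l\<in>{..<r} - {i}. L l ^ b"
  have "f ^ n * (?H * x) \<in> row l (\<mu> l)" if l: "l < r" for l
  proof (cases "l = i")
    case True
    then show ?thesis using ideal_mult_left[OF is_ideal_row assms(3), of ?H] by (simp add: mult_ac)
  next
    case False
    hence "L l ^ b dvd ?H" using l by (intro dvd_prodI) auto
    hence "L l ^ b * MM (\<lambda>_. 0) dvd f ^ n * (?H * x)" by (simp add: MM_def)
    thus ?thesis by (rule row_memI) (use b l in auto)
  qed
  hence "f ^ n * (?H * x) \<in> fat \<mu>" by (simp add: fat_def)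
  hence "?H * x \<in> fat \<mu>" using nonzerodivisor_power[of f "fat \<mu>" n] assms(1) by blast
  hence "?H * x \<in> row i (\<mu> i)" using assms(2) by (simp add: fat_def)
  thus ?thesis by (rule row_cancel_prod_L[rotated 3]) (use assms(2) in auto)
qed

text \<open>The pair is chosen so that its componentwise minimum \<open>v\<close> has the least sum.
  \<open>e l\<close> is the least shift bringing the sum of row \<open>l\<close> down to that of
  \<open>v\<close> or below; by the choice of the pair the shifted row then lies below
  \<open>v\<close> in every column.\<close>

lemma minimal_incomparable_rows:
  assumes "\<not> comparable_rows \<mu>"
  obtains i k i' k' v e where "i < r" "i' < r" "i \<noteq> i'"
    "\<forall>j. v j = min (\<mu> i j - k) (\<mu> i' j - k')"
    "(\<Sum>j<t. v j) < (\<Sum>j<t. \<mu> i j - k)" "(\<Sum>j<t. v j) < (\<Sum>j<t. \<mu> i' j - k')"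
    "\<forall>l<r. \<forall>j<t. \<mu> l j \<le> e l + v j"
    "\<forall>l<r. \<forall>n. e l = Suc n \<longrightarrow> (\<Sum>j<t. v j) < (\<Sum>j<t. \<mu> l j - n)"
proof -
  define inc where "inc = (\<lambda>(i, k, i', k'). i < r \<and> i' < r \<and>
    (\<exists>j<t. \<mu> i' j - k' < \<mu> i j - k) \<and> (\<exists>j<t. \<mu> i j - k < \<mu> i' j - k'))"
  define sz where "sz = (\<lambda>(i, k, i', k'). \<Sum>j<t. min (\<mu> i j - k) (\<mu> i' j - k'))"
  have "\<exists>i k i' k'. inc (i, k, i', k')"
    using assms by (simp add: comparable_rows_def inc_def not_le) blast
  then obtain x where x: "inc x" "\<And>y. inc y \<Longrightarrow> sz x \<le> sz y"
    using ex_has_least_nat[of inc _ sz] by blast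
  obtain i k i' k' where xe: "x = (i, k, i', k')" by (cases x)
  define v where "v j = min (\<mu> i j - k) (\<mu> i' j - k')" for j
  obtain j1 j2 where ir: "i < r" "i' < r" and j1: "j1 < t" "\<mu> i' j1 - k' < \<mu> i j1 - k"
    and j2: "j2 < t" "\<mu> i j2 - k < \<mu> i' j2 - k'" using x(1) by (auto simp: xe inc_def)
  have szx: "sz x = (\<Sum>j<t. v j)" by (simp add: xe sz_def v_def)
  \<comment> \<open>Two shifts of the same row are always comparable.\<close>
  have "i \<noteq> i'"
  proof
    assume "i = i'"
    then show False using j1 j2 by (cases "k \<le> k'") auto
  qed
  have lt1: "(\<Sum>j<t. v j) < (\<Sum>j<t. \<mu> i j - k)"
    using j1 by (intro sum_strict_mono_ex1) (auto simp: v_def intro!: bexI[of _ j1])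
  have lt2: "(\<Sum>j<t. v j) < (\<Sum>j<t. \<mu> i' j - k')"
    using j2 by (intro sum_strict_mono_ex1) (auto simp: v_def intro!: bexI[of _ j2])
  define e where "e l = (LEAST n. (\<Sum>j<t. \<mu> l j - n) \<le> (\<Sum>j<t. v j))" for l
  have e_le: "(\<Sum>j<t. \<mu> l j - e l) \<le> (\<Sum>j<t. v j)" for l
    unfolding e_def
  proof (rule LeastI)
    have "\<mu> l j \<le> (\<Sum>j<t. \<mu> l j)" if "j < t" for j using that by (intro member_le_sum) auto
    thus "(\<Sum>j<t. \<mu> l j - (\<Sum>j<t. \<mu> l j)) \<le> (\<Sum>j<t. v j)" by simp
  qed
  \<comment> \<open>Row \<open>a\<close> with shift \<open>c\<close> will be a member of the chosen
    pair. If the shifted row \<open>l\<close> exceeds it in a column, either the two are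
    incomparable with a smaller minimum, against the choice of the pair, or row \<open>l\<close>
    lies above it everywhere and has a larger sum than \<open>v\<close>.\<close>
  have no_escape: False
    if "l < r" "j < t" "a < r" and le: "\<And>j. v j \<le> \<mu> a j - c" and gt: "\<mu> a j - c < \<mu> l j - e l" for l j a c
  proof (cases "inc (l, e l, a, c)")
    case True
    have "sz (l, e l, a, c) < (\<Sum>j<t. \<mu> l j - e l)"
      unfolding sz_def prod.case using that by (intro sum_strict_mono_ex1) (auto intro!: bexI[of _ j])
    with x(2)[OF True] e_le[of l] szx show False by simp
  next
    case False
    hence "\<forall>j<t. \<mu> a j - c \<le> \<mu> l j - e l" using that(1-3) gt unfolding inc_def prod.case by (metis not_less)
    hence "(\<Sum>j<t. v j) < (\<Sum>j<t. \<mu> l j - e l)"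
      using that by (intro sum_strict_mono_ex1) (auto intro!: bexI[of _ j] intro: le_trans le_less_trans)
    with e_le[of l] show False by simp
  qed
  have cover: "\<mu> l j \<le> e l + v j" if "l < r" "j < t" for l j
  proof (rule ccontr)
    assume "\<not> \<mu> l j \<le> e l + v j"
    hence gt: "v j < \<mu> l j - e l" by linarith
    consider "v j = \<mu> i j - k" | "v j = \<mu> i' j - k'" by (metis v_def min_def)
    then show False
    proof cases
      case 1 then show False using no_escape[of l j i k] that ir gt by (auto simp: v_def)
    next
      case 2 then show False using no_escape[of l j i' k'] that ir gt by (auto simp: v_def)
    qed
  qed
  have below: "(\<Sum>j<t. v j) < (\<Sum>j<t. \<mu> l j - n)" if "e l = Suc n" for l n
    using not_less_Least[of n "\<lambda>n. (\<Sum>j<t. \<mu> l j - n) \<le> (\<Sum>j<t. v j)"] that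
    unfolding e_def by simp
  show ?thesis
    by (rule that[of i i' v k k' e]) (use ir \<open>i \<noteq> i'\<close> v_def lt1 lt2 cover below in auto)
qed

end

section \<open>A regular pair forces comparable rows\<close>

context fat_points
begin

text \<open>The section equal to \<open>F\<close> on line \<open>i\<close> and to 0 on the other
  lines becomes a polynomial after multiplication by powers of \<open>f1\<close> and of
  \<open>f2\<close>. Regularity removes these powers, and the resulting polynomial has, in the
  bidegree of \<open>F\<close>, too many linear factors.\<close>

lemma comparable_rows_of_regular_pair:
  assumes "f1 \<in> max_ideal" "f2 \<in> max_ideal" and reg1: "\<And>g. f1 * g \<in> fat m \<Longrightarrow> g \<in> fat m"
    and reg2: "\<And>g a. f2 * g - a * f1 \<in> fat m \<Longrightarrow> \<exists>b. g - b * f1 \<in> fat m"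
  shows "comparable_rows m"
proof (rule ccontr)
  assume "\<not> comparable_rows m"
  then obtain i k i' k' v e where ir: "i < r" "i' < r" "i \<noteq> i'"
    and v: "\<forall>j. v j = min (m i j - k) (m i' j - k')"
    and lt: "(\<Sum>j<t. v j) < (\<Sum>j<t. m i j - k)" "(\<Sum>j<t. v j) < (\<Sum>j<t. m i' j - k')"
    and cover: "\<forall>l<r. \<forall>j<t. m l j \<le> e l + v j"
    and below: "\<forall>l<r. \<forall>n. e l = Suc n \<longrightarrow> (\<Sum>j<t. v j) < (\<Sum>j<t. m l j - n)"
    by (rule minimal_incomparable_rows)
  \<comment> \<open>The shifts of the pair on its two lines, the least shifts \<open>e\<close>
    elsewhere; so \<open>F\<close> lies in every row other than those of \<open>i\<close> and
    \<open>i'\<close>.\<close>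
  define E where "E = e(i := k, i' := k')"
  define F where "F = (\<Prod>l<r. L l ^ E l) * MM v"
  define D where "D = (\<Sum>l<r. E l)"
  define V where "V = (\<Sum>j<t. v j)"
  have E: "E i = k" "E i' = k'" "\<And>l. l \<noteq> i \<Longrightarrow> l \<noteq> i' \<Longrightarrow> E l = e l" using ir by (auto simp: E_def)
  have homF: "bihomog F (int D, int V)"
    using bihomog_mult[OF bihomog_prod_L[of E "{..<r}"] bihomog_MM[of v]] by (simp add: F_def D_def V_def)
  have LF: "L l ^ E l dvd (\<Prod>l<r. L l ^ E l)" if "l < r" for l using that by (intro dvd_prodI) auto
  have F_row: "F \<in> row l (m l)" if l: "l < r" "l \<noteq> i" "l \<noteq> i'" for l
    by (rule row_memI[of _ "E l" v]) (use LF[OF l(1)] cover l E in \<open>auto simp: F_def mult_dvd_mono\<close>)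

  define b where "b = (\<Sum>l<r. \<Sum>j<t. m l j)"
  have b: "m l j \<le> b" if "l < r" "j < t" for l j
  proof -
    have "m l j \<le> (\<Sum>j<t. m l j)" using that by (intro member_le_sum) auto
    also have "\<dots> \<le> b" unfolding b_def using that by (intro member_le_sum) auto
    finally show ?thesis .
  qed

  \<comment> \<open>\<open>J\<close> consists of the \<open>h\<close> for which \<open>h F\<close> on the row \<open>i\<close> and \<open>0\<close> on the other rows glue
    to a global polynomial.\<close>
  define J where "J = {h. \<exists>p. p - h * F \<in> row i (m i) \<and> (\<forall>l<r. l \<noteq> i \<longrightarrow> p \<in> row l (m l))}"
  have idJ: "is_ideal J" unfolding is_ideal_def
  proof (intro conjI ballI allI)
    show "0 \<in> J" unfolding J_def using ideal_zero[OF is_ideal_row] by (auto intro!: exI[of _ 0])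
  next
    fix a c assume "a \<in> J" "c \<in> J"
    then obtain p q where pq: "p - a * F \<in> row i (m i)" "\<forall>l<r. l \<noteq> i \<longrightarrow> p \<in> row l (m l)"
      "q - c * F \<in> row i (m i)" "\<forall>l<r. l \<noteq> i \<longrightarrow> q \<in> row l (m l)" unfolding J_def by blast
    have "(p - a * F) + (q - c * F) \<in> row i (m i)" using pq by (intro ideal_add is_ideal_row)
    moreover have "\<forall>l<r. l \<noteq> i \<longrightarrow> p + q \<in> row l (m l)" using pq ideal_add[OF is_ideal_row] by blast
    ultimately show "a + c \<in> J" unfolding J_def
      by (intro CollectI exI[of _ "p + q"]) (simp add: algebra_simps)
  next
    fix s a assume "a \<in> J"
    then obtain p where p: "p - a * F \<in> row i (m i)" "\<forall>l<r. l \<noteq> i \<longrightarrow> p \<in> row l (m l)" unfolding J_def by blast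
    have "s * (p - a * F) \<in> row i (m i)" using p by (intro ideal_mult_left is_ideal_row)
    moreover have "\<forall>l<r. l \<noteq> i \<longrightarrow> s * p \<in> row l (m l)" using p ideal_mult_left[OF is_ideal_row] by blast
    ultimately show "s * a \<in> J" unfolding J_def
      by (intro CollectI exI[of _ "s * p"]) (simp add: algebra_simps)
  qed
  \<comment> \<open>Here the zero polynomial glues.\<close>
  have J1: "h \<in> J" if "h * F \<in> row i (m i)" for h
    unfolding J_def using that ideal_diff[OF is_ideal_row ideal_zero[OF is_ideal_row] that]
      ideal_zero[OF is_ideal_row] by (auto intro!: exI[of _ 0])
  \<comment> \<open>Here \<open>h * F\<close> itself glues, since \<open>F\<close> already lies in
    the rows other than \<open>i\<close> and \<open>i'\<close>.\<close>
  have J2: "h \<in> J" if h: "h * F \<in> row i' (m i')" for h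
  proof -
    have "h * F \<in> row l (m l)" if "l < r" "l \<noteq> i" for l
      using that h F_row[of l] ideal_mult_left[OF is_ideal_row, of F] by (cases "l = i'") auto
    thus ?thesis unfolding J_def using ideal_zero[OF is_ideal_row] by (auto intro!: exI[of _ "h * F"])
  qed
  have L_power: "L l ^ b * F \<in> row l (m l)" if "l < r" for l
    by (rule row_memI[of _ b "\<lambda>_. 0"]) (use b that in \<open>auto simp: MM_def\<close>)
  have LiJ: "L i ^ b \<in> J" and Li'J: "L i' ^ b \<in> J" using J1 J2 L_power ir by auto

  \<comment> \<open>\<open>S\<close> and \<open>S'\<close> hold the columns in which the two rows of
    the pair exceed their minimum \<open>v\<close>; no column is in both.\<close>
  define S where "S = {j. j < t \<and> v j < m i j - k}"
  define S' where "S' = {j. j < t \<and> v j < m i' j - k'}"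
  have fin: "finite S" "finite S'" and disj: "S \<inter> S' = {}" by (auto simp: S_def S'_def v)
  have prod_S: "(\<Prod>j\<in>T. M j ^ b) * F \<in> row l (m l)"
    if l: "l < r" and T: "T = {j. j < t \<and> v j < m l j - E l}" for l T
  proof -
    have "(\<Prod>j\<in>T. M j ^ b) = MM (\<lambda>j. if j \<in> T then b else 0)"
      unfolding MM_def T by (rule prod.mono_neutral_cong_left) auto
    hence "(\<Prod>j\<in>T. M j ^ b) * F = (\<Prod>l<r. L l ^ E l) * MM (\<lambda>j. (if j \<in> T then b else 0) + v j)"
      by (simp add: F_def MM_add mult_ac)
    hence "L l ^ E l * MM (\<lambda>j. (if j \<in> T then b else 0) + v j) dvd (\<Prod>j\<in>T. M j ^ b) * F"
      using mult_dvd_mono[OF LF[OF l] dvd_refl] by simp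
    thus ?thesis
    proof (rule row_memI)
      fix j assume "j < t"
      thus "m l j \<le> E l + ((if j \<in> T then b else 0) + v j)"
        using b[OF l, of j] by (auto simp: T)
    qed
  qed
  have PJ: "(\<Prod>j\<in>S. M j ^ b) \<in> J" using J1 prod_S[of i S] ir E by (simp add: S_def)
  have P'J: "(\<Prod>j\<in>S'. M j ^ b) \<in> J" using J2 prod_S[of i' S'] ir E by (simp add: S'_def)

  have X: "Var x ^ (b * b) \<in> J" if x: "x = X0 \<or> x = X1" for x
  proof -
    obtain s u where "Var x = s * L i + u * L i'"
      using Var_in_span_lin[OF R_indep[OF ir] x] by blast
    then obtain s u where "Var x ^ (b * b) = s * L i ^ b + u * L i' ^ b"
      using power_eq_combination_powers by blast
    thus ?thesis using LiJ Li'J by (simp add: ideal_add[OF idJ] ideal_mult_left[OF idJ])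
  qed
  \<comment> \<open>For \<open>j\<close> in \<open>S\<close> and \<open>j'\<close> in
    \<open>S'\<close> the forms \<open>M j\<close> and \<open>M j'\<close> span \<open>Y0\<close>
    and \<open>Y1\<close>. Combining first over \<open>S'\<close> and then over \<open>S\<close>
    writes a power of the variable through the two products, which lie in \<open>J\<close>.\<close>
  have Y: "\<exists>n. Var y ^ n \<in> J" if y: "y = Y0 \<or> y = Y1" for y
  proof -
    let ?P' = "\<Prod>j\<in>S'. M j ^ b"
    have comb: "\<exists>s u. (Var y ^ (b * b)) ^ card S' = s * M j ^ b + u * ?P'" if j: "j \<in> S" for j
    proof -
      have comb: "\<exists>s u. Var y ^ (b * b) = s * M j' ^ b + u * M j ^ b" if "j' \<in> S'" for j'
      proof -
        have "j' < t" "j < t" "j' \<noteq> j" using j that disj by (auto simp: S_def S'_def)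
        then obtain s u where "Var y = s * M j' + u * M j"
          using Var_in_span_lin[OF Q_indep y] by blast
        then show ?thesis by (rule power_eq_combination_powers)
      qed
      have "\<exists>s u. (Var y ^ (b * b)) ^ card S' = s * ?P' + u * M j ^ b"
        by (rule power_eq_combination_prod[OF fin(2)]) (rule comb)
      thus ?thesis by (metis add.commute)
    qed
    have "\<exists>s u. ((Var y ^ (b * b)) ^ card S') ^ card S = s * (\<Prod>j\<in>S. M j ^ b) + u * ?P'"
      by (rule power_eq_combination_prod[OF fin(1)]) (rule comb)
    then obtain s u where "((Var y ^ (b * b)) ^ card S') ^ card S = s * (\<Prod>j\<in>S. M j ^ b) + u * ?P'" by blast
    also have "\<dots> \<in> J" by (intro ideal_add ideal_mult_left idJ PJ P'J)
    finally show ?thesis by (metis power_mult)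
  qed
  have "Var x \<in> {f. \<exists>n. f ^ n \<in> J}" for x using X Y by (cases x) blast+
  hence "max_ideal \<subseteq> {f. \<exists>n. f ^ n \<in> J}"
    unfolding max_ideal_def by (intro ideal_gen_least is_ideal_radical idJ) auto
  with assms(1,2) obtain n1 n2 where "f1 ^ n1 \<in> J" "f2 ^ n2 \<in> J" by blast
  then obtain p1 p2 where p1: "p1 - f1 ^ n1 * F \<in> row i (m i)" "\<forall>l<r. l \<noteq> i \<longrightarrow> p1 \<in> row l (m l)"
    and p2: "p2 - f2 ^ n2 * F \<in> row i (m i)" "\<forall>l<r. l \<noteq> i \<longrightarrow> p2 \<in> row l (m l)"
    unfolding J_def by blast
  \<comment> \<open>\<open>p1\<close> and \<open>p2\<close> represent the section times
    \<open>f1 ^ n1\<close> and \<open>f2 ^ n2\<close>, so the cross products agree on every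
    row.\<close>
  have "f2 ^ n2 * p1 - p2 * f1 ^ n1 \<in> row l (m l)" if l: "l < r" for l
  proof (cases "l = i")
    case True
    have "f2 ^ n2 * (p1 - f1 ^ n1 * F) - f1 ^ n1 * (p2 - f2 ^ n2 * F) \<in> row i (m i)"
      by (intro ideal_diff ideal_mult_left is_ideal_row p1 p2)
    thus ?thesis using True by (simp add: algebra_simps)
  next
    case False
    thus ?thesis unfolding mult.commute[of p2] using p1 p2 l
      by (intro ideal_diff ideal_mult_left is_ideal_row) auto
  qed
  hence "f2 ^ n2 * p1 - p2 * f1 ^ n1 \<in> fat m" by (simp add: fat_def)
  then obtain g where g: "p1 - g * f1 ^ n1 \<in> fat m"
    using regular_pair_powers[OF is_ideal_fat, of f1 m f2 n2 p1 p2 n1] reg1 reg2 by blast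
  have g_row: "p1 - g * f1 ^ n1 \<in> row l (m l)" if "l < r" for l using g that by (simp add: fat_def)
  \<comment> \<open>The power of \<open>f1\<close> cancels row by row: \<open>g\<close> is congruent
    to \<open>F\<close> on line \<open>i\<close> and to 0 on the others.\<close>
  have "(p1 - f1 ^ n1 * F) - (p1 - g * f1 ^ n1) \<in> row i (m i)"
    by (intro ideal_diff is_ideal_row p1 g_row ir)
  hence "f1 ^ n1 * (g - F) \<in> row i (m i)" by (simp add: algebra_simps)
  hence gi: "g - F \<in> row i (m i)" using nonzerodivisor_row[of f1 m i n1 "g - F"] reg1 ir(1) by blast
  have gl: "g \<in> row l (m l)" if l: "l < r" "l \<noteq> i" for l
  proof -
    have "p1 - (p1 - g * f1 ^ n1) \<in> row l (m l)" using p1 l by (intro ideal_diff is_ideal_row g_row) auto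
    hence "f1 ^ n1 * g \<in> row l (m l)" by (simp add: mult.commute)
    thus ?thesis using nonzerodivisor_row[of f1 m l n1 g] reg1 l(1) by blast
  qed

  define h where "h = bicomp (int D, int V) g"
  have homh: "bihomog h (int D, int V)" by (simp add: h_def bihomog_bicomp)
  have "h - F = bicomp (int D, int V) (g - F)" by (simp add: h_def bicomp_diff bicomp_of_bihomog[OF homF])
  hence "h - F \<in> row i (m i)" using row_bicomp[OF gi] by simp
  hence hi: "L i ^ Suc k dvd h - F"
    by (rule row_low_degree_dvd[OF ir(1) _ bihomog_diff[OF homh homF]]) (use lt in \<open>simp add: V_def del: of_nat_sum\<close>)
  have hl: "L l ^ Suc n dvd h" if l: "l < r" "l \<noteq> i" and n: "V < (\<Sum>j<t. m l j - n)" for l n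
    by (rule row_low_degree_dvd[OF l(1) _ homh]) (use row_bicomp[OF gl[OF l]] n in \<open>auto simp: h_def simp del: of_nat_sum\<close>)
  \<comment> \<open>The exponent at \<open>i'\<close> rises by one because \<open>h\<close> lies in
    row \<open>i'\<close>, whose sum with shift \<open>k'\<close> exceeds \<open>V\<close>.\<close>
  define E' where "E' = E(i' := Suc k')"
  have "L l ^ E' l dvd h" if l: "l < r" for l
  proof -
    consider "l = i" | "l = i'" | "l \<noteq> i" "l \<noteq> i'" by blast
    then show ?thesis
    proof cases
      case 1
      have "L i ^ k dvd F" using LF[OF ir(1)] E by (auto simp: F_def)
      moreover have "L i ^ k dvd h - F" using hi by (meson dvd_trans le_imp_power_dvd le_SucI order_refl)
      ultimately have "L i ^ k dvd (h - F) + F" by (intro dvd_add)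
      thus ?thesis using 1 E ir by (simp add: E'_def)
    next
      case 2
      then show ?thesis using hl[of i' k'] lt ir by (simp add: E'_def V_def)
    next
      case 3
      then show ?thesis using E hl[OF l] below l by (cases "e l") (auto simp: E'_def V_def)
    qed
  qed
  hence "(\<Prod>l<r. L l ^ E' l) dvd h"
    using prime_L L_ndvd_L by (intro prod_prime_powers_dvd) auto
  then obtain z where z: "h = z * (\<Prod>l<r. L l ^ E' l)" by (metis dvdE mult.commute)
  have "(\<Sum>l<r. E' l) = E' i' + (\<Sum>l\<in>{..<r} - {i'}. E' l)" "D = E i' + (\<Sum>l\<in>{..<r} - {i'}. E l)"
    unfolding D_def using ir by (auto intro!: sum.remove)
  moreover have "(\<Sum>l\<in>{..<r} - {i'}. E' l) = (\<Sum>l\<in>{..<r} - {i'}. E l)"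
    by (rule sum.cong) (auto simp: E'_def)
  \<comment> \<open>The divisor of \<open>h\<close> has x-degree \<open>D + 1\<close> while
    \<open>h\<close> has \<open>D\<close>; the cofactor would need x-degree -1, so \<open>h\<close>
    vanishes.\<close>
  ultimately have D': "(\<Sum>l<r. E' l) = Suc D" using E by (simp add: E'_def)
  have "h = bicomp (int D, int V) h" using bicomp_of_bihomog[OF homh] by simp
  also have "\<dots> = bicomp (int D - int (Suc D), int V - 0) z * (\<Prod>l<r. L l ^ E' l)"
    unfolding z using bicomp_mult_bihomog[OF bihomog_prod_L[of E' "{..<r}"]] by (simp add: D')
  also have "bicomp (int D - int (Suc D), int V - 0) z = 0" by (rule bicomp_negative) simp
  finally have "h = 0" by simp
  with hi have "L i ^ Suc k dvd F" by simp
  \<comment> \<open>With \<open>h = 0\<close>, \<open>L i\<close> would divide \<open>F\<close> more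
    than \<open>k\<close> times; after cancelling it would divide another line form or a form in
    y.\<close>
  moreover have "(\<Prod>l<r. L l ^ E l) = L i ^ k * (\<Prod>l\<in>{..<r} - {i}. L l ^ E l)"
    using prod.remove[of "{..<r}" i "\<lambda>l. L l ^ E l"] ir E by simp
  ultimately have "L i ^ k * L i dvd L i ^ k * ((\<Prod>l\<in>{..<r} - {i}. L l ^ E l) * MM v)"
    by (simp add: F_def mult_ac)
  hence "L i dvd (\<Prod>l\<in>{..<r} - {i}. L l ^ E l) * MM v" using L_nonzero[OF ir(1)] by simp
  moreover have "\<not> L i dvd MM v" using L_ndvd_prod_M[OF ir(1)] by (simp add: MM_def)
  ultimately have "L i dvd (\<Prod>l\<in>{..<r} - {i}. L l ^ E l)"
    using prime_elem_dvd_multD[OF prime_L[OF ir(1)]] by blast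
  then obtain l where "l \<in> {..<r} - {i}" "L i dvd L l ^ E l"
    by (rule prime_elem_dvd_prod[OF prime_L[OF ir(1)], rotated]) auto
  thus False using L_ndvd_L[of i l] ir prime_elem_dvd_power[OF prime_L[OF ir(1)]] by auto
qed

end

section \<open>The minimal resolution\<close>

lemma subst_subst: "subst \<kappa> (subst \<theta> p) = subst (\<lambda>v. subst \<kappa> (\<theta> v)) p"
  by (induction p rule: bpoly_induct) (auto simp: subst_Const subst_Var subst_add subst_mult)

lemma prime_ideal_kernel_subst: "prime_ideal {p :: 'k::idom bpoly. subst \<theta> p = 0}"
proof -
  have "(1 :: 'k bpoly) \<notin> {p. subst \<theta> p = 0}" by (simp add: subst_1)
  thus ?thesis unfolding prime_ideal_def is_ideal_def
    by (auto simp: subst_0 subst_add subst_mult)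
qed

lemma Var_in_max_ideal: "Var v \<in> max_ideal"
  unfolding max_ideal_def by (rule subsetD[OF ideal_gen_superset]) simp

lemma lin_in_max_ideal: "lin u v a \<in> max_ideal"
proof -
  have "is_ideal (max_ideal :: 'a bpoly set)" unfolding max_ideal_def by (rule is_ideal_ideal_gen)
  thus ?thesis unfolding lin_def by (intro ideal_diff ideal_mult_left Var_in_max_ideal)
qed

text \<open>The resolution is indexed by bidegrees and the staircase by steps; injectivity of
  \<open>cc\<close> and \<open>vv\<close> translates between them. The matrix has \<open>X p\<close>
  in position \<open>p\<close> and \<open>- Y p\<close> in position \<open>Suc p\<close>.\<close>

lemma has_min_resolution_staircase:
  fixes A B X Y :: "nat \<Rightarrow> 'k::field bpoly"
  assumes inj: "inj_on cc {..q}" "inj_on vv {..<q}"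
    and A: "\<And>p. p < q \<Longrightarrow> A (Suc p) = A p * X p" and B: "\<And>p. p < q \<Longrightarrow> B p = Y p * B (Suc p)"
    and nz: "A 0 \<noteq> 0" "B q \<noteq> 0" "\<And>p. p < q \<Longrightarrow> X p \<noteq> 0" "\<And>p. p < q \<Longrightarrow> Y p \<noteq> 0"
    and cop: "\<And>p h. p < q \<Longrightarrow> Y p dvd h * A (Suc p) \<Longrightarrow> Y p dvd h"
    and homg: "\<And>p. p \<le> q \<Longrightarrow> bihomog (A p * B p) (int (fst (cc p)), int (snd (cc p)))"
    and homX: "\<And>p. p < q \<Longrightarrow> bihomog (X p)
      (int (fst (vv p)) - int (fst (cc p)), int (snd (vv p)) - int (snd (cc p)))"
    and homY: "\<And>p. p < q \<Longrightarrow> bihomog (Y p)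
      (int (fst (vv p)) - int (fst (cc (Suc p))), int (snd (vv p)) - int (snd (cc (Suc p))))"
    and max: "\<And>p. p < q \<Longrightarrow> X p \<in> max_ideal" "\<And>p. p < q \<Longrightarrow> Y p \<in> max_ideal"
    and gen: "ideal_gen ((\<lambda>p. A p * B p) ` {..q}) = I"
  shows "has_min_resolution I (cc ` {..q}) (vv ` {..<q})"
proof -
  define ci where "ci = the_inv_into {..q} cc"
  define vi where "vi = the_inv_into {..<q} vv"
  have ci: "ci (cc p) = p" if "p \<le> q" for p using that inj by (simp add: ci_def the_inv_into_f_f)
  have vi: "vi (vv p) = p" if "p < q" for p using that inj by (simp add: vi_def the_inv_into_f_f)
  define g where "g c = A (ci c) * B (ci c)" for c
  define N where "N v c = (if ci c = vi v then X (vi v) else if ci c = Suc (vi v) then - Y (vi v) else 0)" for v c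
  have g: "g (cc p) = A p * B p" if "p \<le> q" for p using that by (simp add: g_def ci)
  have N: "N (vv p') (cc p) = (if p = p' then X p' else if p = Suc p' then - Y p' else 0)"
    if "p \<le> q" "p' < q" for p p' using that by (simp add: N_def ci vi)
  have sumC: "(\<Sum>c\<in>cc ` {..q}. h c * g c) = (\<Sum>p\<le>q. h (cc p) * (A p * B p))" for h
    using inj(1) by (simp add: sum.reindex g)
  have sumV: "(\<Sum>v\<in>vv ` {..<q}. s v * N v (cc p)) = (if p < q then s (vv p) * X p else 0)
      - (if 0 < p then s (vv (p - 1)) * Y (p - 1) else 0)" if p: "p \<le> q" for s p
  proof -
    have "(\<Sum>v\<in>vv ` {..<q}. s v * N v (cc p)) = (\<Sum>p'<q. s (vv p') * N (vv p') (cc p))"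
      using inj(2) by (simp add: sum.reindex)
    also have "\<dots> = (\<Sum>p'<q. (if p' = p then s (vv p') * X p' else 0)
        - (if 0 < p \<and> p' = p - 1 then s (vv p') * Y p' else 0))"
      by (rule sum.cong) (use p in \<open>auto simp: N\<close>)
    also have "\<dots> = (\<Sum>p'<q. if p' = p then s (vv p') * X p' else 0)
        - (\<Sum>p'<q. if 0 < p \<and> p' = p - 1 then s (vv p') * Y p' else 0)"
      by (rule sum_subtractf)
    also have "(\<Sum>p'<q. if p' = p then s (vv p') * X p' else 0) = (if p < q then s (vv p) * X p else 0)"
      by (simp add: sum.delta)
    also have "(\<Sum>p'<q. if 0 < p \<and> p' = p - 1 then s (vv p') * Y p' else 0)
        = (if 0 < p then s (vv (p - 1)) * Y (p - 1) else 0)"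
      using p by (cases p) (auto simp: sum.delta)
    finally show ?thesis .
  qed
  have maxid: "is_ideal (max_ideal :: 'k bpoly set)" unfolding max_ideal_def by (rule is_ideal_ideal_gen)
  have gI: "g (cc p) \<in> I" if "p \<le> q" for p
    unfolding gen[symmetric] g[OF that] by (rule subsetD[OF ideal_gen_superset]) (use that in auto)
  have "g ` cc ` {..q} = (\<lambda>p. A p * B p) ` {..q}" by (auto simp: g image_image)
  hence gen': "ideal_gen (g ` cc ` {..q}) = I" using gen by simp
  have Nprop: "bihomog (N (vv p') (cc p)) (int (fst (vv p')) - int (fst (cc p)), int (snd (vv p')) - int (snd (cc p)))
      \<and> N (vv p') (cc p) \<in> max_ideal" if "p' < q" "p \<le> q" for p p'
    using that homX homY max ideal_zero[OF maxid] ideal_diff[OF maxid ideal_zero[OF maxid] max(2)[of p']]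
    by (auto simp: N bihomog_0 intro: bihomog_minus)
  have syz: "(\<Sum>c\<in>cc ` {..q}. h c * g c) = 0 \<longleftrightarrow>
      (\<exists>s. \<forall>c\<in>cc ` {..q}. h c = (\<Sum>v\<in>vv ` {..<q}. s v * N v c))" for h
  proof
    assume "(\<Sum>c\<in>cc ` {..q}. h c * g c) = 0"
    hence "(\<Sum>p\<le>q. h (cc p) * (A p * B p)) = 0" by (simp only: sumC)
    note sum0 = this
    have "\<exists>s. \<forall>p\<le>q. h (cc p) = (if p < q then s p * X p else 0) - (if 0 < p then s (p - 1) * Y (p - 1) else 0)"
      by (rule staircase_syzygy_exists[where A = A and B = B])
        (fact A, fact B, fact nz(1), fact nz(2), fact nz(4), fact cop, fact sum0)
    then obtain s where s: "\<forall>p\<le>q. h (cc p) = (if p < q then s p * X p else 0)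
      - (if 0 < p then s (p - 1) * Y (p - 1) else 0)" by blast
    have "h (cc p) = (\<Sum>v\<in>vv ` {..<q}. s (vi v) * N v (cc p))" if "p \<le> q" for p
      unfolding sumV[OF that] using s that by (auto simp: vi)
    thus "\<exists>s. \<forall>c\<in>cc ` {..q}. h c = (\<Sum>v\<in>vv ` {..<q}. s v * N v c)"
      by (intro exI[of _ "\<lambda>v. s (vi v)"]) auto
  next
    assume "\<exists>s. \<forall>c\<in>cc ` {..q}. h c = (\<Sum>v\<in>vv ` {..<q}. s v * N v c)"
    then obtain s where "\<forall>c\<in>cc ` {..q}. h c = (\<Sum>v\<in>vv ` {..<q}. s v * N v c)" by blast
    hence "h (cc p) = (if p < q then s (vv p) * X p else 0)
      - (if 0 < p then s (vv (p - 1)) * Y (p - 1) else 0)" if "p \<le> q" for p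
      using that sumV[OF that, of s] by simp
    hence "(\<Sum>p\<le>q. h (cc p) * (A p * B p)) = (\<Sum>p\<le>q. ((if p < q then s (vv p) * X p else 0)
      - (if 0 < p then s (vv (p - 1)) * Y (p - 1) else 0)) * (A p * B p))"
      by (intro sum.cong) auto
    also have "\<dots> = 0" by (rule staircase_syzygy_sum[where s = "\<lambda>p. s (vv p)"]) (fact A, fact B)
    finally show "(\<Sum>c\<in>cc ` {..q}. h c * g c) = 0" by (simp only: sumC)
  qed
  have injs: "\<forall>v\<in>vv ` {..<q}. s v = 0" if "\<forall>c\<in>cc ` {..q}. (\<Sum>v\<in>vv ` {..<q}. s v * N v c) = 0" for s
  proof -
    have "(if p < q then s (vv p) * X p else 0) - (if 0 < p then s (vv (p - 1)) * Y (p - 1) else 0) = 0"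
      if p: "p \<le> q" for p
      unfolding sumV[OF p, symmetric] using \<open>\<forall>c\<in>cc ` {..q}. _ c = 0\<close> p by blast
    hence "s (vv p) = 0" if "p < q" for p
      using staircase_syzygy_injective[of q X "\<lambda>p. s (vv p)" Y p] nz(3) that by blast
    thus ?thesis by blast
  qed
  show ?thesis unfolding has_min_resolution_def
    by (intro exI[of _ g] exI[of _ N] conjI allI)
      (use gI homg g gen' Nprop syz injs in auto)
qed

text \<open>Serves to number the corners of the staircase. The induction removes the largest element
  \<open>n\<close> and continues with the largest one below it.\<close>

lemma corner_enumeration:
  fixes K :: "nat set"
  assumes "0 \<in> K" "n \<in> K" "\<And>k. k \<in> K \<Longrightarrow> k \<le> n"
  shows "\<exists>q c. c 0 = 0 \<and> c q = n \<and> c ` {..q} = K \<and>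
    (\<forall>p<q. c p < c (Suc p) \<and> (\<forall>k. c p < k \<longrightarrow> k < c (Suc p) \<longrightarrow> k \<notin> K))"
  using assms
proof (induction n arbitrary: K rule: less_induct)
  case (less n)
  show ?case
  proof (cases "n = 0")
    case True
    hence "K = {0}" using less.prems by auto
    thus ?thesis using True by (intro exI[of _ 0] exI[of _ "\<lambda>_. 0"]) auto
  next
    case False
    let ?K = "K \<inter> {..<n}"
    define n' where "n' = Max ?K"
    have n': "n' \<in> ?K" unfolding n'_def using less.prems False by (intro Max_in) auto
    have mx: "k \<le> n'" if "k \<in> K" "k < n" for k unfolding n'_def using that by (intro Max_ge) auto
    have "\<exists>q c. c 0 = 0 \<and> c q = n' \<and> c ` {..q} = ?K \<and>
      (\<forall>p<q. c p < c (Suc p) \<and> (\<forall>k. c p < k \<longrightarrow> k < c (Suc p) \<longrightarrow> k \<notin> ?K))"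
      using n' mx less.prems False by (intro less.IH) auto
    then obtain q c where c: "c 0 = 0" "c q = n'" "c ` {..q} = ?K"
      "\<forall>p<q. c p < c (Suc p) \<and> (\<forall>k. c p < k \<longrightarrow> k < c (Suc p) \<longrightarrow> k \<notin> ?K)" by blast
    have cn: "c p < n" if "p \<le> q" for p using c(3) that by blast
    define c' where "c' = c(Suc q := n)"
    have "c' ` {..Suc q} = insert n (c ` {..q})"
      by (auto simp: c'_def atMost_Suc image_iff)
    also have "\<dots> = K" using c(3) less.prems by (auto simp: le_less)
    finally have im: "c' ` {..Suc q} = K" .
    have step: "c' p < c' (Suc p) \<and> (\<forall>k. c' p < k \<longrightarrow> k < c' (Suc p) \<longrightarrow> k \<notin> K)" if "p < Suc q" for p
    proof (cases "p = q")
      case True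
      then show ?thesis using n' mx c(2) by (force simp: c'_def not_less)
    next
      case False
      hence p: "p < q" using that by simp
      have "c' p = c p" "c' (Suc p) = c (Suc p)" using p by (auto simp: c'_def)
      moreover have "c (Suc p) < n" using cn p by simp
      ultimately show ?thesis using c(4) p by auto
    qed
    show ?thesis using im step c(1) by (intro exI[of _ "Suc q"] exI[of _ c']) (auto simp: c'_def)
  qed
qed

section \<open>Dimension and resolution of a fat point scheme\<close>

context fat_points
begin

text \<open>\<open>\<theta>\<close> restricts polynomials to the cone over one support point, whose
  coordinates are \<open>(a, b)\<close> and \<open>(c, d)\<close>; its multiplicity is positive, so
  the ideal vanishes there.\<close>

lemma fat_subset_kernel:
  obtains \<theta> :: "var \<Rightarrow> 'k bpoly" and a b c d where "(a, b) \<noteq> (0, 0)" "(c, d) \<noteq> (0, 0)"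
    "\<theta> X0 = Const a * Var X0" "\<theta> X1 = Const b * Var X0" "\<theta> Y0 = Const c * Var Y0" "\<theta> Y1 = Const d * Var Y0"
    "fat m \<subseteq> {p. subst \<theta> p = 0}"
proof -
  obtain j where j: "0 < r" "j < t" "0 < m 0 j" using valid unfolding valid_fat_data_def by blast
  define \<theta> where "\<theta> = case_var (Const (fst (R 0)) * Var X0) (Const (snd (R 0)) * Var X0)
    (Const (fst (Q j)) * Var Y0) (Const (snd (Q j)) * Var Y0 :: 'k bpoly)"
  have "subst \<theta> (L 0) = 0" "subst \<theta> (M j) = 0"
    by (simp_all add: lin_def subst_diff subst_mult subst_Const subst_Var \<theta>_def)
  moreover obtain n where "m 0 j = Suc n" using j by (metis gr0_implies_Suc)
  moreover have "fat m \<subseteq> pw (L 0) (M j) (m 0 j)" using j by (auto simp: fat_def row_def)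
  ultimately have "fat m \<subseteq> {p. subst \<theta> p = 0}"
    by (auto elim!: pw_SucE simp: subst_add subst_mult subst_power)
  moreover have "(fst (R 0), snd (R 0)) \<noteq> (0, 0)" "(fst (Q j), snd (Q j)) \<noteq> (0, 0)"
    using R_nonzero[of 0] Q_nonzero[of j] j by auto
  ultimately show ?thesis 
    by (intro that[of "fst (R 0)" "snd (R 0)" "fst (Q j)" "snd (Q j)" \<theta>]) (simp_all add: \<theta>_def)
qed

lemma one_notin_fat: "1 \<notin> fat m"
proof
  obtain \<theta> where "fat m \<subseteq> {p. subst \<theta> p = 0}" by (rule fat_subset_kernel)
  moreover assume "1 \<in> fat m"
  ultimately show False by (auto simp: subst_1)
qed

text \<open>The chain consists of the kernels of restriction to the cone over a support point, then
  setting \<open>X0\<close> and then \<open>Y0\<close> to zero. A nonzero coordinate in each factor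
  shows strictness.\<close>

lemma krull_dim_ge_2: "2 \<le> krull_dim_quot (fat m)"
proof -
  obtain \<theta> :: "var \<Rightarrow> 'k bpoly" and a b c d where ab: "(a, b) \<noteq> (0, 0)" and cd: "(c, d) \<noteq> (0, 0)"
    and \<theta>: "\<theta> X0 = Const a * Var X0" "\<theta> X1 = Const b * Var X0" "\<theta> Y0 = Const c * Var Y0" "\<theta> Y1 = Const d * Var Y0"
    and sub: "fat m \<subseteq> {p. subst \<theta> p = 0}" by (rule fat_subset_kernel)
  define \<kappa> :: "nat \<Rightarrow> var \<Rightarrow> 'k bpoly" where "\<kappa> n = Var (if n = 0 then X0 else Y0 := 0)" for n
  define T where "T n = rec_nat \<theta> (\<lambda>n \<theta>' v. subst (\<kappa> n) (\<theta>' v)) n" for n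
  define P where "P n = {p. subst (T n) p = 0}" for n
  have T_Suc: "T (Suc n) = (\<lambda>v. subst (\<kappa> n) (T n v))" for n by (simp add: T_def)
  have T0: "T 0 = \<theta>" by (simp add: T_def)
  have mono: "P n \<subseteq> P (Suc n)" for n
    unfolding P_def T_Suc by (auto simp: subst_subst[symmetric] subst_0)
  obtain x where x: "x = X0 \<and> a \<noteq> 0 \<or> x = X1 \<and> b \<noteq> 0" using ab by auto
  obtain y where y: "y = Y0 \<and> c \<noteq> 0 \<or> y = Y1 \<and> d \<noteq> 0" using cd by auto
  have "Var x \<in> P 1 - P 0" using x \<theta>
    by (auto simp: P_def subst_Var T0 T_Suc \<kappa>_def subst_mult subst_Const Const_eq_0_iff Var_nonzero)
  moreover have "Var y \<in> P 2 - P 1" using y \<theta>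
    by (auto simp: P_def subst_Var T0 T_Suc \<kappa>_def subst_mult subst_Const Const_eq_0_iff Var_nonzero numeral_2_eq_2)
  ultimately have "P 0 \<subset> P (Suc 0)" "P 1 \<subset> P (Suc 1)"
    using mono[of 0] mono[of 1] by (auto simp: numeral_2_eq_2)
  hence "\<forall>i<2. P i \<subset> P (Suc i)" using less_2_cases by auto
  moreover have "\<forall>i\<le>2. prime_ideal (P i)" by (simp add: P_def prime_ideal_kernel_subst)
  moreover have "fat m \<subseteq> P 0" using sub by (simp add: P_def T0)
  ultimately have "enat 2 \<le> krull_dim_quot (fat m)"
    unfolding krull_dim_quot_def by (intro Sup_upper) blast
  thus ?thesis by (simp add: numeral_eq_enat)
qed

lemma MM_nonzero: "MM w \<noteq> 0"
  using M_nonzero by (auto simp: MM_def)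

lemma MM_cong: "(\<And>j. j < t \<Longrightarrow> u j = w j) \<Longrightarrow> MM u = MM w"
  by (simp add: MM_def)

text \<open>No \<open>M j\<close> divides a line form, so each of its powers passes to
  \<open>h\<close>. This is the coprimality that the syzygies require.\<close>

lemma MM_dvd_cancel:
  assumes "\<And>s. s \<in> S \<Longrightarrow> f s < r" "finite S" "MM w dvd h * (\<Prod>s\<in>S. L (f s))"
  shows "MM w dvd h"
  unfolding MM_def
proof (rule prod_prime_powers_dvd)
  fix j assume j: "j \<in> {..<t}"
  have "\<not> M j dvd (\<Prod>s\<in>S. L (f s))"
  proof
    assume "M j dvd (\<Prod>s\<in>S. L (f s))"
    then obtain s where "s \<in> S" "M j dvd L (f s)"
      using prime_elem_dvd_prod[of "M j" S "\<lambda>s. L (f s)"] prime_M[of j] j assms(2) by auto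
    thus False using M_ndvd_L[of j "f s"] assms(1) j by auto
  qed
  moreover have "M j ^ w j dvd (\<Prod>s\<in>S. L (f s)) * h"
    using assms(3) dvd_prodI[of "{..<t}" j "\<lambda>j. M j ^ w j"] j
    by (auto simp: MM_def mult.commute intro: dvd_trans)
  ultimately show "M j ^ w j dvd h"
    using prime_elem_power_dvd_mult_cancel prime_M[of j] j by auto
qed (use prime_M M_ndvd_M in auto)

lemma alpha_Z_eqI:
  assumes "mset al = (\<Sum>i<r. mset (map (a_Z t m i) [0..<l_Z t m i]))" "sorted (rev al)"
  shows "alpha_Z r t m = al"
proof -
  let ?xs = "concat (map (\<lambda>i. map (a_Z t m i) [0..<l_Z t m i]) [0..<r])"
  have "mset ?xs = (\<Sum>i\<leftarrow>[0..<r]. mset (map (a_Z t m i) [0..<l_Z t m i]))"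
    by (simp add: mset_concat comp_def)
  also have "\<dots> = mset (rev al)"
    using assms(1) by (simp add: interv_sum_list_conv_sum_set_nat atLeast0LessThan)
  finally have "sort ?xs = rev al" using assms(2) by (intro properties_for_sort) auto
  thus ?thesis by (simp add: alpha_Z_def)
qed

text \<open>Peeling yields a generator for each \<open>s \<le> n\<close>; where the row sum does not
  drop, it is a multiple of the preceding one. The generators at the corners remain and form a
  staircase.\<close>

lemma has_min_resolution_of_comparable_rows:
  assumes "comparable_rows m"
  shows "has_min_resolution (fat m) (C_Z (alpha_Z r t m)) (V_Z (alpha_Z r t m))"
proof -
  have "0 < t" using valid by (simp add: valid_fat_data_def)
  from fat_peel_generators[OF assms this] obtain ps where ps: "\<forall>x\<in>set ps. fst x < r"
      "\<forall>s. Suc s < length ps \<longrightarrow> (\<forall>j<t. snd (ps ! Suc s) j \<le> snd (ps ! s) j)"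
      "\<forall>x\<in>set ps. 0 < (\<Sum>j<t. snd x j)"
      "mset (map (\<lambda>x. \<Sum>j<t. snd x j) ps) = (\<Sum>i<r. mset (map (a_Z t m i) [0..<l_Z t m i]))"
      "\<forall>f\<in>fat m. \<exists>c. f = (\<Sum>s\<le>length ps. c s * gen ps s)"
      "\<forall>s\<le>length ps. gen ps s \<in> fat m"
    by (elim exE conjE) (rule that)
  define n where "n = length ps"
  \<comment> \<open>The row at \<open>n\<close> is zero, so the last generator, the product of all
    peeled lines, gives the element \<open>(n, 0)\<close> of \<open>C_Z\<close>.\<close>
  define w where "w s = (if s < n then snd (ps ! s) else (\<lambda>_. 0))" for s
  define \<alpha> where "\<alpha> s = (\<Sum>j<t. w s j)" for s
  define f where "f s = fst (ps ! s)" for s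
  define al where "al = map (\<lambda>x. \<Sum>j<t. snd x j) ps"
  have len: "length al = n" by (simp add: al_def n_def)
  have f: "f s < r" if "s < n" for s using ps(1) that by (simp add: f_def n_def)
  have "ps \<noteq> []"
  proof
    assume "ps = []"
    hence "1 \<in> fat m" using ps(6) by (simp add: gen_def)
    thus False using one_notin_fat by simp
  qed
  hence n0: "0 < n" by (simp add: n_def)
  have gen: "gen ps s = (\<Prod>p<s. L (f p)) * MM (w s)" if "s \<le> n" for s
    using that by (simp add: gen_def f_def w_def n_def MM_def)
  have al_nth: "al ! s = \<alpha> s" if "s < n" for s using that by (simp add: al_def \<alpha>_def w_def n_def)
  have w_Suc: "w (Suc s) j \<le> w s j" if "j < t" for s j using ps(2) that by (simp add: w_def n_def)
  have w_mono: "w s' j \<le> w s j" if "s \<le> s'" "j < t" for s s' j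
    using that(1) by (induction rule: dec_induct) (use w_Suc[OF that(2)] le_trans in blast)+
  have \<alpha>_mono: "\<alpha> s' \<le> \<alpha> s" if "s \<le> s'" for s s' unfolding \<alpha>_def using w_mono that by (intro sum_mono) auto
  have w_eq: "w s j = w s' j" if "s \<le> s'" "\<alpha> s = \<alpha> s'" "j < t" for s s' j
  proof (rule ccontr)
    assume "w s j \<noteq> w s' j"
    hence "w s' j < w s j" using w_mono[OF that(1,3)] by simp
    hence "\<alpha> s' < \<alpha> s" unfolding \<alpha>_def using that w_mono by (intro sum_strict_mono_ex1) auto
    thus False using that by simp
  qed
  have \<alpha>_pos: "0 < \<alpha> s" if "s < n" for s using ps(3) that by (simp add: \<alpha>_def w_def n_def)
  have \<alpha>_n: "\<alpha> n = 0" by (simp add: \<alpha>_def w_def)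

  have "sorted (rev al)"
    unfolding sorted_wrt_iff_nth_less
  proof (intro allI impI)
    fix x y assume "x < y" "y < length (rev al)"
    thus "rev al ! x \<le> rev al ! y" using \<alpha>_mono by (simp add: rev_nth len al_nth)
  qed
  hence alpha: "alpha_Z r t m = al" using ps(4) by (intro alpha_Z_eqI) (simp_all add: al_def)

  \<comment> \<open>The corners: 0 and the steps at which \<open>\<alpha>\<close> drops. The last
    step \<open>n\<close> is one, since the final row is nonzero and
    \<open>\<alpha> n = 0\<close>.\<close>
  define K where "K = {s. s \<le> n \<and> (s = 0 \<or> \<alpha> s < \<alpha> (s - 1))}"
  have "0 \<in> K" "n \<in> K" using n0 \<alpha>_n \<alpha>_pos[of "n - 1"] by (auto simp: K_def)
  moreover have "k \<le> n" if "k \<in> K" for k using that by (simp add: K_def)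
  ultimately obtain q c where c: "c 0 = 0" "c q = n" "c ` {..q} = K"
    "\<forall>p<q. c p < c (Suc p) \<and> (\<forall>k. c p < k \<longrightarrow> k < c (Suc p) \<longrightarrow> k \<notin> K)"
    using corner_enumeration[of K n] by blast
  have cK: "c p \<in> K" if "p \<le> q" for p using c(3) that by blast
  have cn: "c p \<le> n" if "p \<le> q" for p using cK[OF that] by (simp add: K_def)
  have c_less: "c p < c p'" if "p < p'" "p' \<le> q" for p p'
    using that
  proof (induction p' rule: less_induct)
    case (less p')
    then obtain p'' where p'': "p' = Suc p''" by (cases p') auto
    have "c p'' < c p'" using c(4) less.prems p'' by auto
    moreover have "p = p'' \<or> c p < c p''" using less p'' by (cases "p = p''") auto
    ultimately show ?case by auto
  qed
  have c_inj: "inj_on c {..q}"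
    by (rule inj_onI) (metis atMost_iff c_less linorder_neqE_nat less_irrefl)
  have const: "\<alpha> s = \<alpha> (c p)" if "p < q" "c p \<le> s" "s < c (Suc p)" for p s
    using that(2,3)
  proof (induction s rule: dec_induct)
    case (step s)
    have "Suc s \<notin> K" using c(4) that(1) step by auto
    moreover have "Suc s \<le> n" using step cn[of "Suc p"] that(1) by simp
    ultimately have "\<alpha> s \<le> \<alpha> (Suc s)" by (simp add: K_def)
    thus ?case using \<alpha>_mono[of s "Suc s"] step by simp
  qed simp
  \<comment> \<open>The value just before a corner, which occurs in \<open>V_Z\<close>, is that of
    the preceding corner.\<close>
  have before: "\<alpha> (c (Suc p) - 1) = \<alpha> (c p)" if "p < q" for p
    using const[OF that, of "c (Suc p) - 1"] c(4) that by fastforce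
  have drop: "\<alpha> (c (Suc p)) < \<alpha> (c p)" if "p < q" for p
  proof -
    have "c (Suc p) \<in> K" "c (Suc p) \<noteq> 0" using cK[of "Suc p"] c_less[of p "Suc p"] that by auto
    thus ?thesis using before[OF that] by (simp add: K_def)
  qed

  define cc where "cc p = (c p, \<alpha> (c p))" for p
  \<comment> \<open>The bidegree of the least common multiple of the generators at corners
    \<open>p\<close> and \<open>Suc p\<close>.\<close>
  define vv where "vv p = (c (Suc p), \<alpha> (c p))" for p
  have K_pos: "K - {0} = (\<lambda>p. c (Suc p)) ` {..<q}"
  proof -
    have "K - {0} = c ` ({..q} - {0})"
      using c(3) c(1) inj_on_image_set_diff[OF c_inj, of "{..q}" "{0}"] by simp
    also have "{..q} - {0} = Suc ` {..<q}" by (auto simp: image_iff Bex_def) (metis Suc_le_eq not0_implies_Suc)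
    finally show ?thesis by (simp add: image_image)
  qed
  \<comment> \<open>Passes from counting from 1 to list positions, with
    \<open>s = i - 1\<close>.\<close>
  have inner: "(\<exists>i. P (i - 1) (i - 2) \<and> 2 \<le> i \<and> i \<le> n) \<longleftrightarrow> (\<exists>s. P s (s - 1) \<and> 0 < s \<and> s < n)" for P
  proof
    assume "\<exists>i. P (i - 1) (i - 2) \<and> 2 \<le> i \<and> i \<le> n"
    then obtain i where "P (i - 1) (i - 2)" "2 \<le> i" "i \<le> n" by blast
    thus "\<exists>s. P s (s - 1) \<and> 0 < s \<and> s < n" by (intro exI[of _ "i - 1"]) (auto simp: numeral_2_eq_2)
  next
    assume "\<exists>s. P s (s - 1) \<and> 0 < s \<and> s < n"
    then obtain s where "P s (s - 1)" "0 < s" "s < n" by blast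
    thus "\<exists>i. P (i - 1) (i - 2) \<and> 2 \<le> i \<and> i \<le> n" by (intro exI[of _ "Suc s"]) (auto simp: numeral_2_eq_2)
  qed
  have C: "C_Z al = cc ` {..q}"
  proof -
    have "x \<in> C_Z al \<longleftrightarrow> x \<in> (\<lambda>s. (s, \<alpha> s)) ` K" for x
    proof -
      have "x \<in> C_Z al \<longleftrightarrow> x = (n, 0) \<or> x = (0, al ! 0) \<or>
          (\<exists>i. (x = (i - 1, al ! (i - 1)) \<and> al ! (i - 1) < al ! (i - 2)) \<and> 2 \<le> i \<and> i \<le> n)"
        unfolding C_Z_def len by blast
      also have "\<dots> \<longleftrightarrow> x = (n, 0) \<or> x = (0, al ! 0) \<or>
          (\<exists>s. (x = (s, al ! s) \<and> al ! s < al ! (s - 1)) \<and> 0 < s \<and> s < n)"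
        unfolding inner[of "\<lambda>a b. x = (a, al ! a) \<and> al ! a < al ! b"] ..
      also have "\<dots> \<longleftrightarrow> x = (n, \<alpha> n) \<or> x = (0, \<alpha> 0) \<or>
          (\<exists>s. (x = (s, \<alpha> s) \<and> \<alpha> s < \<alpha> (s - 1)) \<and> 0 < s \<and> s < n)"
        using n0 \<alpha>_n by (auto simp: al_nth)
      also have "\<dots> \<longleftrightarrow> x \<in> (\<lambda>s. (s, \<alpha> s)) ` K"
        using \<open>0 \<in> K\<close> \<open>n \<in> K\<close> by (auto simp: K_def image_iff le_less)
      finally show ?thesis .
    qed
    thus ?thesis unfolding cc_def c(3)[symmetric] by (auto simp: image_image)
  qed
  have V: "V_Z al = vv ` {..<q}"
  proof -
    have "x \<in> V_Z al \<longleftrightarrow> x \<in> (\<lambda>s. (s, \<alpha> (s - 1))) ` (K - {0})" for x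
    proof -
      have "x \<in> V_Z al \<longleftrightarrow> x = (n, al ! (n - 1)) \<or>
          (\<exists>i. (x = (i - 1, al ! (i - 2)) \<and> al ! (i - 1) < al ! (i - 2)) \<and> 2 \<le> i \<and> i \<le> n)"
        unfolding V_Z_def len by blast
      also have "\<dots> \<longleftrightarrow> x = (n, al ! (n - 1)) \<or>
          (\<exists>s. (x = (s, al ! (s - 1)) \<and> al ! s < al ! (s - 1)) \<and> 0 < s \<and> s < n)"
        unfolding inner[of "\<lambda>a b. x = (a, al ! b) \<and> al ! a < al ! b"] ..
      also have "\<dots> \<longleftrightarrow> x = (n, \<alpha> (n - 1)) \<or>
          (\<exists>s. (x = (s, \<alpha> (s - 1)) \<and> \<alpha> s < \<alpha> (s - 1)) \<and> 0 < s \<and> s < n)"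
        using n0 by (auto simp: al_nth)
      also have "\<dots> \<longleftrightarrow> x \<in> (\<lambda>s. (s, \<alpha> (s - 1))) ` (K - {0})"
        using \<open>n \<in> K\<close> n0 by (auto simp: K_def image_iff le_less)
      finally show ?thesis .
    qed
    hence "V_Z al = (\<lambda>s. (s, \<alpha> (s - 1))) ` (K - {0})" by blast
    also have "\<dots> = (\<lambda>p. (c (Suc p), \<alpha> (c (Suc p) - 1))) ` {..<q}"
      unfolding K_pos by (simp only: image_image)
    also have "\<dots> = vv ` {..<q}"
      by (rule image_cong) (use before in \<open>auto simp: vv_def\<close>)
    finally show ?thesis .
  qed

  define A where "A p = (\<Prod>s<c p. L (f s))" for p
  define B where "B p = MM (w (c p))" for p
  \<comment> \<open>\<open>X p\<close> collects the lines peeled between two corners and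
    \<open>Y p\<close> the column forms lost there: the two entries of a syzygy.\<close>
  define X where "X p = (\<Prod>s\<in>{c p..<c (Suc p)}. L (f s))" for p
  define Y where "Y p = MM (\<lambda>j. w (c p) j - w (c (Suc p)) j)" for p
  have homL: "bihomog (\<Prod>s\<in>S. L (f s)) (int (card S), 0)" for S
    using bihomog_prod[of S "\<lambda>s. L (f s)" "\<lambda>_. 1" "\<lambda>_. 0", OF bihomog_lin_X] by simp
  have AB: "A p * B p = gen ps (c p)" if "p \<le> q" for p
    using gen[OF cn[OF that]] by (simp add: A_def B_def)
  have c_step: "c p < c (Suc p)" "c (Suc p) \<le> n" if "p < q" for p
    using c_less[of p "Suc p"] cn[of "Suc p"] that by auto
  have maxid: "is_ideal (max_ideal :: 'k bpoly set)" unfolding max_ideal_def by (rule is_ideal_ideal_gen)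
  have "has_min_resolution (fat m) (cc ` {..q}) (vv ` {..<q})"
  proof (rule has_min_resolution_staircase[where A = A and B = B and X = X and Y = Y])
    show "inj_on cc {..q}" using c_inj by (auto simp: inj_on_def cc_def)
    show "inj_on vv {..<q}"
    proof (rule inj_onI)
      fix x y assume "x \<in> {..<q}" "y \<in> {..<q}" "vv x = vv y"
      thus "x = y" using inj_onD[OF c_inj, of "Suc x" "Suc y"] by (simp add: vv_def)
    qed
    show "A 0 \<noteq> 0" by (simp add: A_def c(1))
    show "B q \<noteq> 0" by (simp add: B_def MM_nonzero)
    show "bihomog (A p * B p) (int (fst (cc p)), int (snd (cc p)))" if "p \<le> q" for p
      using bihomog_mult[OF homL[of "{..<c p}"] bihomog_MM[of "w (c p)"]]
      by (simp add: A_def B_def cc_def \<alpha>_def)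
    show "ideal_gen ((\<lambda>p. A p * B p) ` {..q}) = fat m"
    proof
      show "ideal_gen ((\<lambda>p. A p * B p) ` {..q}) \<subseteq> fat m"
        by (rule ideal_gen_least[OF is_ideal_fat]) (use AB ps(6) cn in \<open>auto simp: n_def\<close>)
      let ?I = "ideal_gen ((\<lambda>p. A p * B p) ` {..q})"
      have gens: "gen ps s \<in> ?I" if "s \<le> n" for s
        using that
      proof (induction s)
        case 0
        have "A 0 * B 0 \<in> ?I" by (rule subsetD[OF ideal_gen_superset]) auto
        then show ?case using AB[of 0] c(1) by simp
      next
        case (Suc s)
        show ?case
        proof (cases "Suc s \<in> K")
          case True
          then obtain p where "p \<le> q" "Suc s = c p" using c(3) by auto
          hence "gen ps (Suc s) = A p * B p" using AB by simp
          thus ?thesis by (simp only:) (rule subsetD[OF ideal_gen_superset], use \<open>p \<le> q\<close> in auto)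
        next
          case False
          \<comment> \<open>Off the corners the row is unchanged, so the generator only gains a line
            factor.\<close>
          hence "\<alpha> s = \<alpha> (Suc s)" using Suc.prems \<alpha>_mono[of s "Suc s"] by (simp add: K_def)
          hence "MM (w (Suc s)) = MM (w s)" using w_eq[of s "Suc s"] by (intro MM_cong) auto
          hence "gen ps (Suc s) = L (f s) * gen ps s" using gen Suc.prems by (simp add: mult_ac)
          thus ?thesis using Suc ideal_mult_left[OF is_ideal_ideal_gen] by simp
        qed
      qed
      show "fat m \<subseteq> ?I"
      proof
        fix g assume "g \<in> fat m"
        from bspec[OF ps(5) this] obtain d where "g = (\<Sum>s\<le>length ps. d s * gen ps s)" ..
        moreover have "(\<Sum>s\<le>length ps. d s * gen ps s) \<in> ?I"
          by (rule ideal_sum[OF is_ideal_ideal_gen], rule ideal_mult_left[OF is_ideal_ideal_gen])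
            (use gens in \<open>simp add: n_def\<close>)
        ultimately show "g \<in> ?I" by simp
      qed
    qed
  next
    fix p assume p: "p < q"
    have set: "{..<c (Suc p)} = {..<c p} \<union> {c p..<c (Suc p)}" using c_step[OF p] by auto
    show "A (Suc p) = A p * X p"
      unfolding A_def X_def set by (rule prod.union_disjoint) auto
    have w_le: "w (c (Suc p)) j \<le> w (c p) j" if "j < t" for j
      using w_mono that c_step[OF p] by simp
    show "B p = Y p * B (Suc p)"
      unfolding B_def Y_def MM_add[symmetric] using w_le by (intro MM_cong) simp
    show "X p \<noteq> 0" using c_step[OF p] f L_nonzero by (auto simp: X_def)
    show "Y p \<noteq> 0" by (simp add: Y_def MM_nonzero)
    show "Y p dvd h" if "Y p dvd h * A (Suc p)" for h
      using that unfolding Y_def A_def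
      by (rule MM_dvd_cancel[of "{..<c (Suc p)}" f, rotated 2]) (use c_step[OF p] f in auto)
    show "bihomog (X p) (int (fst (vv p)) - int (fst (cc p)), int (snd (vv p)) - int (snd (cc p)))"
      using homL[of "{c p..<c (Suc p)}"] c_step[OF p] by (simp add: X_def vv_def cc_def of_nat_diff)
    have "(\<Sum>j<t. w (c p) j - w (c (Suc p)) j) = \<alpha> (c p) - \<alpha> (c (Suc p))"
      unfolding \<alpha>_def using w_le by (intro sum_subtractf_nat) auto
    thus "bihomog (Y p) (int (fst (vv p)) - int (fst (cc (Suc p))), int (snd (vv p)) - int (snd (cc (Suc p))))"
      using bihomog_MM[of "\<lambda>j. w (c p) j - w (c (Suc p)) j"] drop[OF p]
      by (simp add: Y_def vv_def cc_def of_nat_diff del: of_nat_sum)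
    have "L (f (c p)) dvd X p" unfolding X_def using c_step[OF p] by (intro dvd_prodI) auto
    thus "X p \<in> max_ideal" using ideal_dvd[OF maxid lin_in_max_ideal] by blast
    \<comment> \<open>The strict drop of \<open>\<alpha>\<close> yields a column with positive
      exponent, so \<open>Y p\<close> is not a unit and the resolution is minimal.\<close>
    obtain j where j: "j < t" "w (c (Suc p)) j < w (c p) j"
      using drop[OF p] sum_mono[of "{..<t}" "w (c p)" "w (c (Suc p))"] unfolding \<alpha>_def
      by (metis lessThan_iff not_le)
    hence "M j ^ (w (c p) j - w (c (Suc p)) j) dvd Y p"
      unfolding Y_def MM_def by (intro dvd_prodI) auto
    moreover have "M j dvd M j ^ (w (c p) j - w (c (Suc p)) j)" using j by (intro dvd_power) auto
    ultimately show "Y p \<in> max_ideal" using ideal_dvd[OF maxid lin_in_max_ideal] dvd_trans by blast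
  qed
  thus ?thesis by (simp add: alpha C V)
qed

end

theorem theorem4p11:
  fixes r t :: nat and R Q :: "nat \<Rightarrow> 'k::alg_closed_field \<times> 'k"
    and m :: "nat \<Rightarrow> nat \<Rightarrow> nat"
  assumes "valid_fat_data r t R Q m"
    and "cohen_macaulay_quot (fat_ideal r t R Q m)"
  shows "has_min_resolution (fat_ideal r t R Q m)
           (C_Z (alpha_Z r t m)) (V_Z (alpha_Z r t m))"
proof -
  interpret fat_points r t R Q m by unfold_locales (rule assms(1))
  \<comment> \<open>The Cohen-Macaulay hypothesis enters through this inequality.\<close>
  have "2 \<le> depth_quot (fat m)"
    using assms(2) krull_dim_ge_2 by (simp add: cohen_macaulay_quot_def fat_ideal_eq_fat)
  then obtain f1 f2 where "f1 \<in> max_ideal" "f2 \<in> max_ideal" "\<And>g. f1 * g \<in> fat m \<Longrightarrow> g \<in> fat m"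
    "\<And>g a. f2 * g - a * f1 \<in> fat m \<Longrightarrow> \<exists>b. g - b * f1 \<in> fat m"
    using regular_pair_of_depth[OF is_ideal_fat] by metis
  hence "comparable_rows m" by (rule comparable_rows_of_regular_pair)
  thus ?thesis unfolding fat_ideal_eq_fat by (rule has_min_resolution_of_comparable_rows)
qed

end
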